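(* Let $F=\prod_{s\in S}\mathbb{F}_{q_s}/\mathcal{D}$ be an ultra-finite field, with internal cardinality $\kappa=\mathrm{ulim}_{s\in S}q_s\in\mathbb{N}^{\#}$. Let $n\in\mathbb{N}^{\#}$ be a hypernatural number such that $n$ divides $\kappa-1$ in $\mathbb{Z}^{\#}$. Let $P$ and $Q$ be monic irreducible polynomials in $F[t]$ of degrees $d$ and $\ell$, respectively. Then $$\left(\frac{Q}{P}\right)_n=(-1)^{\frac{\kappa-1}{n}d\ell}\left(\frac{P}{Q}\right)_n .$$
   Context: Fix an infinite set $S$ and a nonprincipal ultrafilter $\mathcal{D}$ on $S$; "for $\mathcal{D}$-almost all $s$" means for all $s$ in some set belonging to $\mathcal{D}$. $\prod_{s\in S}A_s/\mathcal{D}$ denotes the ultraproduct of sets $A_s$, and $\mathrm{ulim}_{s\in S}a_s$ the class of $(a_s)_{s\in S}$. Hyperintegers: $\mathbb{Z}^{\#}=\prod_{s\in S}\mathbb{Z}/\mathcal{D}$; hypernaturals: $\mathbb{N}^{\#}=\prod_{s\in S}\mathbb{N}/\mathcal{D}$ with $\mathbb{N}=\{1,2,\ldots\}$; $\mathbb{Z}\subset\mathbb{Z}^{\#}$ diagonally. $a$ divides $b$ in $\mathbb{Z}^{\#}$ if $b=ac$ for some $c\in\mathbb{Z}^{\#}$. An ultra-finite field is $F=\prod_{s\in S}\mathbb{F}_{q_s}/\mathcal{D}$, where $\mathbb{F}_{q_s}$ is the finite field with $q_s$ elements ($q_s$ a prime power) for $\mathcal{D}$-almost all $s$. Its internal cardinality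 is $\kappa=\mathrm{ulim}_s q_s$. Let $\mathcal{U}(F[t])=\prod_{s\in S}\mathbb{F}_{q_s}[t]/\mathcal{D}$ (the ultra-hull of $F[t]$). $F[t]$ is a subring of $\mathcal{U}(F[t])$ by sending $\sum_{i\le m}a_it^i$, $a_i=\mathrm{ulim}_s a_{i,s}$, to $\mathrm{ulim}_s\sum_{i\le m}a_{i,s}t^i$. For an element $a=\mathrm{ulim}_s a_s$ of an ultraproduct of rings and a nonnegative hyperinteger $e=\mathrm{ulim}_s e_s$, put $a^e:=\mathrm{ulim}_s a_s^{e_s}$. Power residue symbol: let $n\in\mathbb{N}^{\#}$ divide $\kappa-1$ and let $P\in F[t]$ be irreducible of degree $d\in\mathbb{Z}_{>0}$. For $\alpha\in F[t]$ not divisible by $P$, $\left(\frac{\alpha}{P}\right)_n$ is the unique element of $F^{\times}$ with $\alpha^{\frac{\kappa^d-1}{n}}\equiv\left(\frac{\alpha}{P}\right)_n \pmod{P\,\mathcal{U}(F[t])}$; if $P$ divides $\alpha$, $\left(\frac{\alpha}{P}\right)_n:=0$. *)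

theory Defs
  imports "HOL-Algebra.Algebra"
begin

section \<open>Ultraproducts\<close>

text \<open>
  The index set $S$ is a type, and an ultrafilter on it is given as a filter \<open>D\<close> in the sense
  of HOL: the members of the ultrafilter are the sets \<open>X\<close> with \<open>eventually (\<lambda>s. s \<in> X) D\<close>, so
  \<open>\<forall>\<^sub>F s in D. P s\<close> says that \<open>P s\<close> holds for almost all \<open>s\<close>.
\<close>

definition nonprincipal_ultrafilter :: "'s filter \<Rightarrow> bool" where
  "nonprincipal_ultrafilter D \<longleftrightarrow>
     D \<noteq> bot \<and>
     (\<forall>P. eventually P D \<or> eventually (\<lambda>s. \<not> P s) D) \<and>
     (\<forall>s. D \<noteq> principal {s})"

definition ulim :: "'s filter \<Rightarrow> ('s \<Rightarrow> 'a) \<Rightarrow> ('s \<Rightarrow> 'a) set" where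
  "ulim D a = {b. \<forall>\<^sub>F s in D. b s = a s}"

text \<open>
  Members of a family need only lie in \<open>A s\<close> for almost all \<open>s\<close>. If all the \<open>A s\<close> are nonempty,
  this gives the same classes as the families in the full product; the weaker requirement
  makes the ultraproduct insensitive to the \<open>A s\<close> on a null set of indices.
\<close>

definition ultraproduct :: "'s filter \<Rightarrow> ('s \<Rightarrow> 'a set) \<Rightarrow> ('s \<Rightarrow> 'a) set set" where
  "ultraproduct D A = ulim D ` {a. \<forall>\<^sub>F s in D. a s \<in> A s}"

definition urep :: "('s \<Rightarrow> 'a) set \<Rightarrow> 's \<Rightarrow> 'a" where
  "urep x = (SOME a. a \<in> x)"

lemma ulim_eq_iff: "ulim D a = ulim D b \<longleftrightarrow> (\<forall>\<^sub>F s in D. a s = b s)"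
proof
  assume "ulim D a = ulim D b"
  moreover have "a \<in> ulim D a"
    by (simp add: ulim_def)
  ultimately show "\<forall>\<^sub>F s in D. a s = b s"
    by (simp add: ulim_def)
next
  assume ab: "\<forall>\<^sub>F s in D. a s = b s"
  have "(\<forall>\<^sub>F s in D. c s = a s) \<longleftrightarrow> (\<forall>\<^sub>F s in D. c s = b s)" for c
    by (rule iffI; erule eventually_elim2[OF _ ab]; simp)
  then show "ulim D a = ulim D b"
    by (simp add: ulim_def)
qed

lemma urep_ulim: "\<forall>\<^sub>F s in D. urep (ulim D a) s = a s"
proof -
  have "a \<in> ulim D a"
    by (simp add: ulim_def)
  then have "urep (ulim D a) \<in> ulim D a"
    unfolding urep_def by (rule someI[where P = "\<lambda>b. b \<in> ulim D a"])
  then show ?thesis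
    by (simp add: ulim_def)
qed

lemma ulim_urep: "x \<in> ultraproduct D A \<Longrightarrow> ulim D (urep x) = x"
  unfolding ultraproduct_def by (erule imageE) (simp add: ulim_eq_iff urep_ulim)

definition ultraproduct_ring ::
  "'s filter \<Rightarrow> ('s \<Rightarrow> ('a, 'b) ring_scheme) \<Rightarrow> ('s \<Rightarrow> 'a) set ring" where
  "ultraproduct_ring D R =
     \<lparr>carrier = ultraproduct D (\<lambda>s. carrier (R s)),
      monoid.mult = (\<lambda>x y. ulim D (\<lambda>s. urep x s \<otimes>\<^bsub>R s\<^esub> urep y s)),
      one = ulim D (\<lambda>s. \<one>\<^bsub>R s\<^esub>),
      ring.zero = ulim D (\<lambda>s. \<zero>\<^bsub>R s\<^esub>),
      add = (\<lambda>x y. ulim D (\<lambda>s. urep x s \<oplus>\<^bsub>R s\<^esub> urep y s))\<rparr>"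

lemma ultraproduct_ring_mult:
  "ulim D a \<otimes>\<^bsub>ultraproduct_ring D R\<^esub> ulim D b = ulim D (\<lambda>s. a s \<otimes>\<^bsub>R s\<^esub> b s)"
  unfolding ultraproduct_ring_def
  by (simp add: ulim_eq_iff) (use urep_ulim[of D a] urep_ulim[of D b] in eventually_elim, simp)

lemma ultraproduct_ring_add:
  "ulim D a \<oplus>\<^bsub>ultraproduct_ring D R\<^esub> ulim D b = ulim D (\<lambda>s. a s \<oplus>\<^bsub>R s\<^esub> b s)"
  unfolding ultraproduct_ring_def
  by (simp add: ulim_eq_iff) (use urep_ulim[of D a] urep_ulim[of D b] in eventually_elim, simp)


section \<open>Hyperintegers and internal powers\<close>

definition hyperint :: "'s filter \<Rightarrow> ('s \<Rightarrow> int) set ring" where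
  "hyperint D = ultraproduct_ring D (\<lambda>_. int_ring)"

text \<open>The hypernaturals, formed from the positive integers, as a subset of the hyperintegers.\<close>

definition hypernat :: "'s filter \<Rightarrow> ('s \<Rightarrow> int) set set" where
  "hypernat D = ultraproduct D (\<lambda>_. {1..})"

definition hyper_of_int :: "'s filter \<Rightarrow> int \<Rightarrow> ('s \<Rightarrow> int) set" where
  "hyper_of_int D k = ulim D (\<lambda>_. k)"

definition hyper_quot :: "'s filter \<Rightarrow> ('s \<Rightarrow> int) set \<Rightarrow> ('s \<Rightarrow> int) set \<Rightarrow> ('s \<Rightarrow> int) set" where
  "hyper_quot D a b = (THE c. c \<in> carrier (hyperint D) \<and> a = b \<otimes>\<^bsub>hyperint D\<^esub> c)"

text \<open>
  The power of an element of an ultraproduct of the rings \<open>R s\<close> by a nonnegative hyperinteger.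
\<close>

definition ultra_pow ::
  "'s filter \<Rightarrow> ('s \<Rightarrow> ('a, 'b) ring_scheme) \<Rightarrow> ('s \<Rightarrow> 'a) set \<Rightarrow> ('s \<Rightarrow> int) set \<Rightarrow> ('s \<Rightarrow> 'a) set"
  where
  "ultra_pow D R a e = ulim D (\<lambda>s. urep a s [^]\<^bsub>R s\<^esub> nat (urep e s))"

lemma ultra_pow_ulim:
  "ultra_pow D R (ulim D a) (ulim D e) = ulim D (\<lambda>s. a s [^]\<^bsub>R s\<^esub> nat (e s))"
  unfolding ultra_pow_def
  by (simp add: ulim_eq_iff) (use urep_ulim[of D a] urep_ulim[of D e] in eventually_elim, simp)


section \<open>Ultra-finite fields and the ultra-hull of their polynomial rings\<close>

text \<open>
  Below, \<open>K\<close> is a family of rings, almost all of them finite fields. The ultra-finite field is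
  \<open>F = ultraproduct_ring D K\<close>.
\<close>

definition internal_card :: "'s filter \<Rightarrow> ('s \<Rightarrow> ('a, 'b) ring_scheme) \<Rightarrow> ('s \<Rightarrow> int) set" where
  "internal_card D K = ulim D (\<lambda>s. int (card (carrier (K s))))"

definition ultra_hull ::
  "'s filter \<Rightarrow> ('s \<Rightarrow> ('a, 'b) ring_scheme) \<Rightarrow> ('s \<Rightarrow> 'a list) set ring" where
  "ultra_hull D K = ultraproduct_ring D (\<lambda>s. poly_ring (K s))"

text \<open>
  The inclusion of $F[t]$ into its ultra-hull. An element of \<open>poly_ring F\<close> is its list of
  coefficients, the leading one first; the lists of representatives at an index \<open>s\<close> may begin
  with zeros (for a null set of \<open>s\<close>), which \<open>normalize\<close> removes.
\<close>

definition hull_embed ::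
  "'s filter \<Rightarrow> ('s \<Rightarrow> ('a, 'b) ring_scheme) \<Rightarrow> ('s \<Rightarrow> 'a) set list \<Rightarrow> ('s \<Rightarrow> 'a list) set" where
  "hull_embed D K p = ulim D (\<lambda>s. ring.normalize (K s) (map (\<lambda>c. urep c s) p))"


section \<open>The power residue symbol\<close>

definition power_residue_symbol ::
  "'s filter \<Rightarrow> ('s \<Rightarrow> ('a, 'b) ring_scheme) \<Rightarrow> ('s \<Rightarrow> int) set \<Rightarrow>
     ('s \<Rightarrow> 'a) set list \<Rightarrow> ('s \<Rightarrow> 'a) set list \<Rightarrow> ('s \<Rightarrow> 'a) set" where
  "power_residue_symbol D K n \<alpha> P =
     (let F = ultraproduct_ring D K;
          U = ultra_hull D K;
          Z = hyperint D;
          e = hyper_quot D (internal_card D K [^]\<^bsub>Z\<^esub> Polynomials.degree P \<ominus>\<^bsub>Z\<^esub> \<one>\<^bsub>Z\<^esub>) n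
      in if P pdivides\<^bsub>F\<^esub> \<alpha> then \<zero>\<^bsub>F\<^esub>
         else (THE c. c \<in> Units F \<and>
                 ultra_pow D (\<lambda>s. poly_ring (K s)) (hull_embed D K \<alpha>) e
                   \<ominus>\<^bsub>U\<^esub> hull_embed D K (ring.poly_of_const F c)
                   \<in> PIdl\<^bsub>U\<^esub> (hull_embed D K P)))"

end

theory Submission
  imports Defs
begin

text \<open>
  The law is an identity between resultants. Let $K$ be a finite field with $q$ elements, let $P$
  and $Q$ be distinct monic irreducible polynomials over $K$ of degrees $d$ and $l$, and let $a$ and
  $b$ be roots of $P$ and $Q$ in an extension field. The roots of $P$ are the $d$ distinct conjugates
  $a^{q^i}$ and those of $Q$ are the $b^{q^j}$, so with $N_d = 1 + q + \dots + q^{d-1}$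
  \[ Q(a)^{N_d} = \prod_{i<d} Q(a^{q^i}) = \prod_{i<d} \prod_{j<l} (a^{q^i} - b^{q^j}) \]
  and likewise for $P(b)^{N_l}$. The two double products differ by the sign $(-1)^{dl}$, and they are
  fixed by the $q$-th power map, hence lie in $K$. Since $(q^d - 1)/n = N_d (q-1)/n$, raising to the
  power $(q-1)/n$ gives the reciprocity law over $K$ (\<open>finite_field_power_reciprocity\<close>).

  That $x \mapsto x^q$ is additive on the extension, that its fixed points are the elements of $K$
  and that the conjugates of $a$ are distinct are all obtained from one elementary fact: a
  monic polynomial of degree $m$ with $m$ distinct roots $s$ takes the value $\prod_s (x - s)$ at $x$
  (\<open>monic_eval_eq_finprod\<close>).

  The law passes to the ultraproduct as follows. A polynomial over the ultra-finite field $F$ has a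
  coordinate polynomial over \<open>K s\<close> for each index \<open>s\<close>; its image in the ultra-hull is the class of
  these. Coordinates almost everywhere commute with multiplication of polynomials, and
  families of polynomials of one fixed degree come from polynomials over $F$. Therefore the
  coordinates of an irreducible polynomial are irreducible almost everywhere
  (\<open>eventually_pirreducible\<close>), and the power residue symbol over $F$ is the class of the symbols
  at the indices (\<open>power_residue_symbol_eq_ulim\<close>).
\<close>

section \<open>Monic polynomials with many roots\<close>

text \<open>Division by $x - s$ with Horner's scheme: the quotient \<open>g\<close> is empty for constant \<open>p\<close> and
  otherwise has the same leading coefficient; the remainder is the value at \<open>s\<close>.\<close>

lemma (in cring) synthetic_division:
  assumes "p \<noteq> []" "set p \<subseteq> carrier R" "s \<in> carrier R"
  shows "\<exists>g. set g \<subseteq> carrier R \<and> length p = Suc (length g) \<and> (g \<noteq> [] \<longrightarrow> hd g = hd p) \<and>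
             (\<forall>x\<in>carrier R. eval p x = (x \<ominus> s) \<otimes> eval g x \<oplus> eval p s)"
  using assms
proof (induction p rule: rev_induct)
  case Nil
  then show ?case by simp
next
  case (snoc c p)
  show ?case
  proof (cases "p = []")
    case True
    with snoc.prems show ?thesis
      by (intro exI[of _ "[]"]) simp
  next
    case False
    have c: "c \<in> carrier R" "set p \<subseteq> carrier R" "s \<in> carrier R" "eval p s \<in> carrier R"
      using snoc.prems eval_in_carrier by auto
    obtain g where g: "set g \<subseteq> carrier R" "length p = Suc (length g)"
        "g \<noteq> [] \<longrightarrow> hd g = hd p"
        "\<And>x. x \<in> carrier R \<Longrightarrow> eval p x = (x \<ominus> s) \<otimes> eval g x \<oplus> eval p s"
      using snoc.IH[OF False c(2,3)] by blast
    have eq: "eval (p @ [c]) x = (x \<ominus> s) \<otimes> eval (g @ [eval p s]) x \<oplus> eval (p @ [c]) s"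
      if x: "x \<in> carrier R" for x
    proof -
      have gx: "eval g x \<in> carrier R"
        using g(1) x eval_in_carrier by auto
      have "eval (p @ [c]) x = ((x \<ominus> s) \<otimes> eval g x \<oplus> eval p s) \<otimes> x \<oplus> c"
        using eval_append_aux[OF c(2,1) x] g(4)[OF x] by simp
      also have "\<dots> = (x \<ominus> s) \<otimes> (eval g x \<otimes> x \<oplus> eval p s) \<oplus> (eval p s \<otimes> s \<oplus> c)"
        using gx c x by algebra
      finally show ?thesis
        using eval_append_aux[OF c(2,1,3)] eval_append_aux[OF g(1) c(4) x] by simp
    qed
    have hd: "hd (g @ [eval p s]) = hd (p @ [c])"
    proof (cases "g = []")
      case True
      then obtain k where "p = [k]"
        using g(2) by (cases p) simp_all
      then show ?thesis
        using True c by simp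
    qed (use g(3) False in simp)
    show ?thesis
      by (intro exI[of _ "g @ [eval p s]"] conjI ballI impI hd eq) (use g(1,2) c in simp_all)
  qed
qed

lemma (in domain) monic_eval_eq_finprod:
  assumes "finite S" "S \<subseteq> carrier R" "set p \<subseteq> carrier R" "length p = Suc (card S)" "hd p = \<one>"
    and "\<And>s. s \<in> S \<Longrightarrow> eval p s = \<zero>" "x \<in> carrier R"
  shows "eval p x = (\<Otimes>s\<in>S. x \<ominus> s)"
  using assms
proof (induction S arbitrary: p rule: finite_induct)
  case empty
  then have "p = [\<one>]"
    by (cases p) auto
  then show ?case by simp
next
  case (insert s S)
  have s: "s \<in> carrier R" "S \<subseteq> carrier R"
    using insert.prems by auto
  have x: "x \<in> carrier R"
    by fact
  have "p \<noteq> []"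
    using insert.prems by auto
  then obtain g where g: "set g \<subseteq> carrier R" "length p = Suc (length g)"
      "g \<noteq> [] \<longrightarrow> hd g = hd p"
      "\<And>x. x \<in> carrier R \<Longrightarrow> eval p x = (x \<ominus> s) \<otimes> eval g x \<oplus> eval p s"
    using synthetic_division[OF _ insert.prems(2) s(1)] by blast
  have ps: "eval p s = \<zero>"
    using insert.prems by simp
  have len: "length g = Suc (card S)"
    using g(2) insert by simp
  have g_car: "eval g y \<in> carrier R" if "y \<in> carrier R" for y
    using g(1) that eval_in_carrier by auto
  have eq: "eval p y = (y \<ominus> s) \<otimes> eval g y" if "y \<in> carrier R" for y
    using g(4)[OF that] g_car[OF that] ps s that by simp
  have "eval g t = \<zero>" if t: "t \<in> S" for t
  proof -
    have tc: "t \<in> carrier R" and "t \<noteq> s"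
      using s t insert.hyps by auto
    then have "t \<ominus> s \<noteq> \<zero>"
      using s by (simp add: r_right_minus_eq)
    moreover have "(t \<ominus> s) \<otimes> eval g t = \<zero>"
      using eq[OF tc] insert.prems t by simp
    ultimately show ?thesis
      using integral[of "t \<ominus> s" "eval g t"] g_car[OF tc] tc s by auto
  qed
  then have "eval g x = (\<Otimes>s\<in>S. x \<ominus> s)"
    using insert.IH[OF s(2) g(1) len] g(3) len insert.prems by fastforce
  moreover have "(\<Otimes>t\<in>insert s S. x \<ominus> t) = (x \<ominus> s) \<otimes> (\<Otimes>t\<in>S. x \<ominus> t)"
    using insert.hyps s x by (intro finprod_insert) auto
  ultimately show ?case
    using eq[OF x] by simp
qed

lemma (in domain) finprod_eq_zero_imp:
  assumes "finite S" "f \<in> S \<rightarrow> carrier R" "(\<Otimes>s\<in>S. f s) = \<zero>"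
  shows "\<exists>s\<in>S. f s = \<zero>"
  using assms
proof (induction S rule: finite_induct)
  case (insert s S)
  then have "f s \<otimes> (\<Otimes>t\<in>S. f t) = \<zero>"
    by (simp add: Pi_def)
  moreover have "f s \<in> carrier R" "(\<Otimes>t\<in>S. f t) \<in> carrier R"
    using insert.prems by (auto intro!: finprod_closed)
  ultimately have "f s = \<zero> \<or> (\<Otimes>t\<in>S. f t) = \<zero>"
    by (simp add: integral_iff)
  then show ?case
    using insert.IH insert.prems(1) by auto
qed simp

lemma (in domain) monic_card_roots_le:
  assumes "finite S" "S \<subseteq> carrier R" "set p \<subseteq> carrier R" "length p = Suc n" "hd p = \<one>"
    and "\<And>s. s \<in> S \<Longrightarrow> eval p s = \<zero>"
  shows "card S \<le> n"
proof (rule ccontr)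
  assume "\<not> card S \<le> n"
  then obtain T where T: "T \<subseteq> S" "card T = n" "finite T"
    using obtain_subset_with_card_n[of n S] by auto
  then have "T \<noteq> S"
    using \<open>\<not> card S \<le> n\<close> by auto
  then obtain x where x: "x \<in> S" "x \<notin> T"
    using T(1) by blast
  have xc: "x \<in> carrier R"
    using x assms by auto
  have "(\<Otimes>t\<in>T. x \<ominus> t) = eval p x"
    by (rule monic_eval_eq_finprod[symmetric]) (use T assms xc in auto)
  then have "\<exists>t\<in>T. x \<ominus> t = \<zero>"
    using assms(2,6) x T xc by (intro finprod_eq_zero_imp) auto
  then show False
    using x T assms(2) xc by (auto simp: r_right_minus_eq subset_eq)
qed

text \<open>The list \<open>g\<close> represents $(y + x) p(y) + c$. The constant is needed for the induction along
  Horner's scheme; appending it to \<open>p\<close> states the leading coefficient also for empty \<open>p\<close>.\<close>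

lemma (in cring) mult_linear_add_const:
  assumes "set p \<subseteq> carrier R" "x \<in> carrier R" "c \<in> carrier R"
  shows "\<exists>g. set g \<subseteq> carrier R \<and> length g = Suc (length p) \<and> hd g = hd (p @ [c]) \<and>
             (\<forall>y\<in>carrier R. eval g y = (y \<oplus> x) \<otimes> eval p y \<oplus> c)"
  using assms(1,3)
proof (induction p arbitrary: c rule: rev_induct)
  case Nil
  then show ?case
    using assms(2) by (intro exI[of _ "[c]"]) simp
next
  case (snoc b p)
  have c: "b \<in> carrier R" "set p \<subseteq> carrier R" "c \<in> carrier R"
    using snoc.prems by auto
  then obtain g where g: "set g \<subseteq> carrier R" "length g = Suc (length p)" "hd g = hd (p @ [b])"
      "\<And>y. y \<in> carrier R \<Longrightarrow> eval g y = (y \<oplus> x) \<otimes> eval p y \<oplus> b"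
    using snoc.IH[OF c(2,1)] by blast
  let ?e = "b \<otimes> x \<oplus> c"
  have e: "?e \<in> carrier R"
    using c assms by simp
  have eq: "eval (g @ [?e]) y = (y \<oplus> x) \<otimes> eval (p @ [b]) y \<oplus> c" if y: "y \<in> carrier R" for y
  proof -
    have "eval p y \<in> carrier R"
      using c y eval_in_carrier by auto
    then have "((y \<oplus> x) \<otimes> eval p y \<oplus> b) \<otimes> y \<oplus> ?e = (y \<oplus> x) \<otimes> (eval p y \<otimes> y \<oplus> b) \<oplus> c"
      using c(1,3) y assms(2) by algebra
    then show ?thesis
      using eval_append_aux[OF g(1) e y] eval_append_aux[OF c(2,1) y] g(4)[OF y] by simp
  qed
  have hd: "hd (g @ [?e]) = hd ((p @ [b]) @ [c])"
    using g(2,3) by (cases g; cases p) simp_all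
  show ?case
    by (intro exI[of _ "g @ [?e]"] conjI ballI hd eq) (use g(1,2) e in simp_all)
qed

lemma (in cring) monic_linear_power:
  assumes "x \<in> carrier R"
  shows "\<exists>p. set p \<subseteq> carrier R \<and> length p = Suc n \<and> hd p = \<one> \<and>
             (\<forall>y\<in>carrier R. eval p y = (y \<oplus> x) [^] n)"
proof (induction n)
  case 0
  then show ?case
    by (intro exI[of _ "[\<one>]"]) simp
next
  case (Suc n)
  then obtain p where p: "set p \<subseteq> carrier R" "length p = Suc n" "hd p = \<one>"
      "\<And>y. y \<in> carrier R \<Longrightarrow> eval p y = (y \<oplus> x) [^] n"
    by blast
  obtain g where g: "set g \<subseteq> carrier R" "length g = Suc (length p)" "hd g = hd (p @ [\<zero>])"
      "\<And>y. y \<in> carrier R \<Longrightarrow> eval g y = (y \<oplus> x) \<otimes> eval p y \<oplus> \<zero>"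
    using mult_linear_add_const[OF p(1) assms zero_closed] by blast
  have "hd g = \<one>"
    using g(3) p(2,3) by (cases p) auto
  moreover have "eval g y = (y \<oplus> x) [^] Suc n" if "y \<in> carrier R" for y
    using g(4)[OF that] p(4)[OF that] that assms by (simp add: m_comm)
  ultimately show ?case
    using g p by auto
qed

text \<open>The monic polynomial $(y + x)^n - y + z$ of degree $n \<ge> 2$.\<close>

lemma (in cring) monic_shifted_power_diff:
  assumes "x \<in> carrier R" "z \<in> carrier R" "n \<ge> 2"
  shows "\<exists>p. set p \<subseteq> carrier R \<and> length p = Suc n \<and> hd p = \<one> \<and>
             (\<forall>y\<in>carrier R. eval p y = (y \<oplus> x) [^] n \<ominus> y \<oplus> z)"
proof -
  obtain m where m: "n = Suc (Suc m)"
    using assms(3) by (metis Suc_le_D Suc_le_mono numeral_2_eq_2)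
  obtain p where p: "set p \<subseteq> carrier R" "length p = Suc m" "hd p = \<one>"
      "\<And>y. y \<in> carrier R \<Longrightarrow> eval p y = (y \<oplus> x) [^] m"
    using monic_linear_power[OF assms(1)] by blast
  obtain g where g: "set g \<subseteq> carrier R" "length g = Suc (length p)" "hd g = hd (p @ [\<ominus> \<one>])"
      "\<And>y. y \<in> carrier R \<Longrightarrow> eval g y = (y \<oplus> x) \<otimes> eval p y \<oplus> \<ominus> \<one>"
    using mult_linear_add_const[OF p(1) assms(1), of "\<ominus> \<one>"] by auto
  have xz: "x \<oplus> z \<in> carrier R"
    using assms by simp
  obtain f where f: "set f \<subseteq> carrier R" "length f = Suc (length g)" "hd f = hd (g @ [x \<oplus> z])"
      "\<And>y. y \<in> carrier R \<Longrightarrow> eval f y = (y \<oplus> x) \<otimes> eval g y \<oplus> (x \<oplus> z)"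
    using mult_linear_add_const[OF g(1) assms(1) xz] by blast
  have "hd f = \<one>"
    using f(3) g(2,3) p(2,3) by (cases p; cases g) auto
  moreover have "eval f y = (y \<oplus> x) [^] n \<ominus> y \<oplus> z" if y: "y \<in> carrier R" for y
  proof -
    define w where "w = (y \<oplus> x) [^] m"
    have w: "w \<in> carrier R" "(y \<oplus> x) [^] n = (y \<oplus> x) \<otimes> ((y \<oplus> x) \<otimes> w)"
      using y assms(1) by (auto simp: w_def m m_comm)
    have "(y \<oplus> x) \<otimes> ((y \<oplus> x) \<otimes> w \<oplus> \<ominus> \<one>) \<oplus> (x \<oplus> z) = (y \<oplus> x) \<otimes> ((y \<oplus> x) \<otimes> w) \<ominus> y \<oplus> z"
      using y assms(1,2) w(1) by algebra
    then show ?thesis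
      using f(4)[OF y] g(4)[OF y] p(4)[OF y] w by (simp add: w_def)
  qed
  ultimately show ?thesis
    using f g p m by auto
qed

section \<open>Finite fields and their extensions\<close>

lemma (in domain) pow_eq_zero_imp:
  assumes "x \<in> carrier R" "x [^] (n::nat) = \<zero>"
  shows "x = \<zero>"
  using assms by (induction n) (auto simp: integral_iff)

text \<open>A homomorphism \<open>h\<close> from a finite field \<open>R\<close> to an arbitrary field \<open>S\<close>. The base field need not be a
  subset of \<open>S\<close>; its copy in \<open>S\<close> is \<open>h ` carrier R\<close>. The number of elements of \<open>R\<close> is \<open>q\<close>, and \<open>ev p x\<close>
  is the value at a point \<open>x\<close> of \<open>S\<close> of the polynomial \<open>p\<close> over \<open>R\<close>.\<close>

locale finite_field_extension = ring_hom_ring R S h + R: field R + S: field S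
  for R (structure) and S (structure) and h +
  assumes finite_R: "finite (carrier R)"
begin

abbreviation q :: nat where "q \<equiv> card (carrier R)"

abbreviation ev :: "'a list \<Rightarrow> 'c \<Rightarrow> 'c" where "ev p \<equiv> S.eval (map h p)"

lemma q_ge_2: "q \<ge> 2"
proof -
  have "card {\<zero>\<^bsub>R\<^esub>, \<one>\<^bsub>R\<^esub>} \<le> q"
    by (intro card_mono finite_R) auto
  then show ?thesis
    using R.one_not_zero by (metis card_2_iff)
qed

lemma inj_h: "inj_on h (carrier R)"
  by (rule non_trivial_field_hom_is_inj[OF homh R.field_axioms S.field_axioms])

lemma R_pow_q:
  assumes "x \<in> carrier R"
  shows "x [^]\<^bsub>R\<^esub> q = x"
proof (cases "x = \<zero>\<^bsub>R\<^esub>")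
  case True
  then show ?thesis
    using q_ge_2 by (simp add: R.nat_pow_zero)
next
  case False
  have "card (Units R) = q - 1"
    using R.field_Units finite_R by simp
  moreover have "x [^]\<^bsub>R\<^esub> card (Units R) = \<one>\<^bsub>R\<^esub>"
    using finite_R False assms R.field_Units by (intro R.units_power_order_eq_one) auto
  ultimately have "x [^]\<^bsub>R\<^esub> Suc (q - 1) = x"
    using assms by simp
  then show ?thesis
    using q_ge_2 by simp
qed

text \<open>The elements of the base field are the $q$ roots of $y^q - y$.\<close>

lemma pow_q_minus_self:
  assumes "x \<in> carrier S"
  shows "x [^]\<^bsub>S\<^esub> q \<ominus>\<^bsub>S\<^esub> x = (\<Otimes>\<^bsub>S\<^esub>c\<in>h ` carrier R. x \<ominus>\<^bsub>S\<^esub> c)"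
proof -
  obtain p where p: "set p \<subseteq> carrier S" "length p = Suc q" "hd p = \<one>\<^bsub>S\<^esub>"
      "\<forall>y\<in>carrier S. S.eval p y = (y \<oplus>\<^bsub>S\<^esub> \<zero>\<^bsub>S\<^esub>) [^]\<^bsub>S\<^esub> q \<ominus>\<^bsub>S\<^esub> y \<oplus>\<^bsub>S\<^esub> \<zero>\<^bsub>S\<^esub>"
    using S.monic_shifted_power_diff[OF S.zero_closed S.zero_closed q_ge_2] by blast
  have ev_p: "S.eval p y = y [^]\<^bsub>S\<^esub> q \<ominus>\<^bsub>S\<^esub> y" if "y \<in> carrier S" for y
    using p(4) that by simp
  have "S.eval p c = \<zero>\<^bsub>S\<^esub>" if c: "c \<in> h ` carrier R" for c
  proof -
    obtain k where k: "k \<in> carrier R" "c = h k"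
      using c by blast
    then have "c [^]\<^bsub>S\<^esub> q = c"
      using R_pow_q[OF k(1)] hom_nat_pow[OF k(1), of q] by simp
    then show ?thesis
      using ev_p k by (simp add: S.r_right_minus_eq)
  qed
  then have "S.eval p x = (\<Otimes>\<^bsub>S\<^esub>c\<in>h ` carrier R. x \<ominus>\<^bsub>S\<^esub> c)"
    using p(1-3) finite_R inj_h assms
    by (intro S.monic_eval_eq_finprod) (auto simp: card_image)
  then show ?thesis
    using ev_p assms by simp
qed

text \<open>Translation by \<open>c\<close> permutes the base field, hence the factors of the product.\<close>

lemma pow_q_minus_self_shift:
  assumes "x \<in> carrier S" "c \<in> h ` carrier R"
  shows "(c \<oplus>\<^bsub>S\<^esub> x) [^]\<^bsub>S\<^esub> q \<ominus>\<^bsub>S\<^esub> (c \<oplus>\<^bsub>S\<^esub> x) = x [^]\<^bsub>S\<^esub> q \<ominus>\<^bsub>S\<^esub> x"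
proof -
  let ?T = "\<lambda>x. x [^]\<^bsub>S\<^esub> q \<ominus>\<^bsub>S\<^esub> x" and ?B = "h ` carrier R"
  have c: "c \<in> carrier S"
    using assms(2) by auto
  have inj: "inj_on (\<lambda>k. c \<oplus>\<^bsub>S\<^esub> k) ?B"
    using c by (intro inj_onI) auto
  obtain c' where c': "c' \<in> carrier R" "c = h c'"
    using assms(2) by blast
  have "c \<oplus>\<^bsub>S\<^esub> h k \<in> ?B" if "k \<in> carrier R" for k
    using hom_add[OF c'(1) that] R.a_closed[OF c'(1) that] unfolding c'(2) by force
  then have "(\<lambda>k. c \<oplus>\<^bsub>S\<^esub> k) ` ?B \<subseteq> ?B"
    by blast
  then have im: "(\<lambda>k. c \<oplus>\<^bsub>S\<^esub> k) ` ?B = ?B"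
    using inj finite_R by (intro endo_inj_surj) simp_all
  have "?T (c \<oplus>\<^bsub>S\<^esub> x) = (\<Otimes>\<^bsub>S\<^esub>k\<in>(\<lambda>k. c \<oplus>\<^bsub>S\<^esub> k) ` ?B. (c \<oplus>\<^bsub>S\<^esub> x) \<ominus>\<^bsub>S\<^esub> k)"
    unfolding im using c assms(1) by (intro pow_q_minus_self S.a_closed)
  also have "\<dots> = (\<Otimes>\<^bsub>S\<^esub>k\<in>?B. (c \<oplus>\<^bsub>S\<^esub> x) \<ominus>\<^bsub>S\<^esub> (c \<oplus>\<^bsub>S\<^esub> k))"
    using inj c assms(1) by (intro S.finprod_reindex) auto
  also have "\<dots> = (\<Otimes>\<^bsub>S\<^esub>k\<in>?B. x \<ominus>\<^bsub>S\<^esub> k)"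
  proof (rule S.finprod_cong')
    fix k assume "k \<in> ?B"
    then have "k \<in> carrier S"
      by auto
    then show "(c \<oplus>\<^bsub>S\<^esub> x) \<ominus>\<^bsub>S\<^esub> (c \<oplus>\<^bsub>S\<^esub> k) = x \<ominus>\<^bsub>S\<^esub> k"
      using c assms(1) by algebra
  qed (use assms(1) in auto)
  also have "\<dots> = ?T x"
    using pow_q_minus_self[OF assms(1)] by simp
  finally show ?thesis .
qed

text \<open>The $q$-th power map is additive: the polynomial $(y + x)^q - y - x^q$ in $y$ is monic of
  degree $q$ and vanishes on the base field, hence it equals $y^q - y$.\<close>

lemma frobenius_add:
  assumes "x \<in> carrier S" "y \<in> carrier S"
  shows "(y \<oplus>\<^bsub>S\<^esub> x) [^]\<^bsub>S\<^esub> q = y [^]\<^bsub>S\<^esub> q \<oplus>\<^bsub>S\<^esub> x [^]\<^bsub>S\<^esub> q"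
proof -
  let ?T = "\<lambda>x. x [^]\<^bsub>S\<^esub> q \<ominus>\<^bsub>S\<^esub> x" and ?B = "h ` carrier R"
  have nx: "\<ominus>\<^bsub>S\<^esub> (x [^]\<^bsub>S\<^esub> q) \<in> carrier S"
    using assms by simp
  obtain p where p: "set p \<subseteq> carrier S" "length p = Suc q" "hd p = \<one>\<^bsub>S\<^esub>"
      "\<forall>y\<in>carrier S. S.eval p y = (y \<oplus>\<^bsub>S\<^esub> x) [^]\<^bsub>S\<^esub> q \<ominus>\<^bsub>S\<^esub> y \<oplus>\<^bsub>S\<^esub> \<ominus>\<^bsub>S\<^esub> (x [^]\<^bsub>S\<^esub> q)"
    using S.monic_shifted_power_diff[OF assms(1) nx q_ge_2] by blast
  have "S.eval p c = \<zero>\<^bsub>S\<^esub>" if "c \<in> ?B" for c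
  proof -
    define u where "u = (c \<oplus>\<^bsub>S\<^esub> x) [^]\<^bsub>S\<^esub> q"
    define v where "v = x [^]\<^bsub>S\<^esub> q"
    have c: "c \<in> carrier S" "u \<in> carrier S" "v \<in> carrier S"
      using that assms by (auto simp: u_def v_def)
    have eq: "u \<ominus>\<^bsub>S\<^esub> (c \<oplus>\<^bsub>S\<^esub> x) = v \<ominus>\<^bsub>S\<^esub> x"
      using pow_q_minus_self_shift[OF assms(1) that] by (simp add: u_def v_def)
    have "u \<ominus>\<^bsub>S\<^esub> c \<oplus>\<^bsub>S\<^esub> \<ominus>\<^bsub>S\<^esub> v = (u \<ominus>\<^bsub>S\<^esub> (c \<oplus>\<^bsub>S\<^esub> x)) \<ominus>\<^bsub>S\<^esub> (v \<ominus>\<^bsub>S\<^esub> x)"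
      using c assms by algebra
    also have "\<dots> = \<zero>\<^bsub>S\<^esub>"
      using c assms unfolding eq by (simp add: S.r_right_minus_eq)
    finally show ?thesis
      using p(4) c by (simp add: u_def v_def)
  qed
  then have "S.eval p y = (\<Otimes>\<^bsub>S\<^esub>c\<in>?B. y \<ominus>\<^bsub>S\<^esub> c)"
    using p(1-3) finite_R inj_h assms
    by (intro S.monic_eval_eq_finprod) (auto simp: card_image)
  also have "\<dots> = ?T y"
    using pow_q_minus_self[OF assms(2)] by simp
  finally have eq: "(y \<oplus>\<^bsub>S\<^esub> x) [^]\<^bsub>S\<^esub> q \<ominus>\<^bsub>S\<^esub> y \<oplus>\<^bsub>S\<^esub> \<ominus>\<^bsub>S\<^esub> (x [^]\<^bsub>S\<^esub> q) = y [^]\<^bsub>S\<^esub> q \<ominus>\<^bsub>S\<^esub> y"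
    using p(4) assms by simp
  define u where "u = (y \<oplus>\<^bsub>S\<^esub> x) [^]\<^bsub>S\<^esub> q"
  define v where "v = x [^]\<^bsub>S\<^esub> q"
  define w where "w = y [^]\<^bsub>S\<^esub> q"
  have car: "u \<in> carrier S" "v \<in> carrier S" "w \<in> carrier S"
    using assms by (auto simp: u_def v_def w_def)
  have "u = (u \<ominus>\<^bsub>S\<^esub> y \<oplus>\<^bsub>S\<^esub> \<ominus>\<^bsub>S\<^esub> v) \<oplus>\<^bsub>S\<^esub> v \<oplus>\<^bsub>S\<^esub> y"
    using car assms by algebra
  also have "\<dots> = (w \<ominus>\<^bsub>S\<^esub> y) \<oplus>\<^bsub>S\<^esub> v \<oplus>\<^bsub>S\<^esub> y"
    using eq by (simp add: u_def v_def w_def)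
  also have "\<dots> = w \<oplus>\<^bsub>S\<^esub> v"
    using car assms by algebra
  finally show ?thesis
    by (simp add: u_def v_def w_def)
qed

lemma ev_closed:
  assumes "set p \<subseteq> carrier R" "x \<in> carrier S"
  shows "ev p x \<in> carrier S"
  using assms by (intro S.eval_in_carrier) auto

lemma ev_pow_q:
  assumes "set p \<subseteq> carrier R" "x \<in> carrier S"
  shows "ev p (x [^]\<^bsub>S\<^esub> q) = ev p x [^]\<^bsub>S\<^esub> q"
  using assms(1)
proof (induction p)
  case Nil
  then show ?case
    using q_ge_2 by (simp add: S.nat_pow_zero)
next
  case (Cons a p)
  have a: "a \<in> carrier R" "h a \<in> carrier S" "ev p x \<in> carrier S"
    using Cons.prems assms(2) ev_closed by auto
  have "h a [^]\<^bsub>S\<^esub> q = h a"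
    using R_pow_q[OF a(1)] hom_nat_pow[OF a(1), of q] by simp
  moreover have "(x [^]\<^bsub>S\<^esub> q) [^]\<^bsub>S\<^esub> length p = (x [^]\<^bsub>S\<^esub> length p) [^]\<^bsub>S\<^esub> q"
    using assms(2) by (simp add: S.nat_pow_pow mult.commute)
  ultimately show ?case
    using a assms(2) Cons by (simp add: frobenius_add S.nat_pow_distrib)
qed

lemma ev_pow_q_power:
  assumes "set p \<subseteq> carrier R" "x \<in> carrier S"
  shows "ev p (x [^]\<^bsub>S\<^esub> (q ^ i)) = ev p x [^]\<^bsub>S\<^esub> (q ^ i)"
proof (induction i)
  case 0
  then show ?case
    using assms ev_closed by simp
next
  case (Suc i)
  have "ev p (x [^]\<^bsub>S\<^esub> (q ^ Suc i)) = ev p ((x [^]\<^bsub>S\<^esub> (q ^ i)) [^]\<^bsub>S\<^esub> q)"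
    using assms by (simp add: S.nat_pow_pow mult.commute)
  also have "\<dots> = (ev p x [^]\<^bsub>S\<^esub> (q ^ i)) [^]\<^bsub>S\<^esub> q"
    using assms Suc by (simp add: ev_pow_q)
  also have "\<dots> = ev p x [^]\<^bsub>S\<^esub> (q ^ Suc i)"
    using assms ev_closed by (simp add: S.nat_pow_pow mult.commute)
  finally show ?case .
qed

lemma pow_q_inj:
  assumes "x \<in> carrier S" "y \<in> carrier S" "x [^]\<^bsub>S\<^esub> q = y [^]\<^bsub>S\<^esub> q"
  shows "x = y"
proof -
  define z where "z = x \<ominus>\<^bsub>S\<^esub> y"
  have z: "z \<in> carrier S" "x = z \<oplus>\<^bsub>S\<^esub> y"
    using assms(1,2) unfolding z_def by (simp, algebra)
  have "x [^]\<^bsub>S\<^esub> q = z [^]\<^bsub>S\<^esub> q \<oplus>\<^bsub>S\<^esub> y [^]\<^bsub>S\<^esub> q"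
    unfolding z(2) using assms(2) z(1) by (rule frobenius_add)
  then have "z [^]\<^bsub>S\<^esub> q = \<zero>\<^bsub>S\<^esub>"
    using assms z(1) S.add.r_cancel_one'[of "y [^]\<^bsub>S\<^esub> q" "z [^]\<^bsub>S\<^esub> q"] by simp
  then have "z = \<zero>\<^bsub>S\<^esub>"
    using z(1) S.pow_eq_zero_imp by blast
  then show ?thesis
    using assms by (simp add: z_def S.r_right_minus_eq)
qed

lemma pow_q_power_inj:
  assumes "x \<in> carrier S" "y \<in> carrier S" "x [^]\<^bsub>S\<^esub> (q ^ i) = y [^]\<^bsub>S\<^esub> (q ^ i)"
  shows "x = y"
  using assms(3)
proof (induction i)
  case 0
  then show ?case
    using assms by simp
next
  case (Suc i)
  have "(x [^]\<^bsub>S\<^esub> (q ^ i)) [^]\<^bsub>S\<^esub> q = (y [^]\<^bsub>S\<^esub> (q ^ i)) [^]\<^bsub>S\<^esub> q"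
    unfolding S.nat_pow_pow[OF assms(1)] S.nat_pow_pow[OF assms(2)] power_Suc2[symmetric]
    by (rule Suc.prems)
  then have "x [^]\<^bsub>S\<^esub> (q ^ i) = y [^]\<^bsub>S\<^esub> (q ^ i)"
    by (rule pow_q_inj[OF S.nat_pow_closed[OF assms(1)] S.nat_pow_closed[OF assms(2)]])
  then show ?case
    by (rule Suc.IH)
qed

lemma pow_q_fixed_imp_base:
  assumes "x \<in> carrier S" "x [^]\<^bsub>S\<^esub> q = x"
  shows "x \<in> h ` carrier R"
proof -
  have "(\<Otimes>\<^bsub>S\<^esub>c\<in>h ` carrier R. x \<ominus>\<^bsub>S\<^esub> c) = \<zero>\<^bsub>S\<^esub>"
    unfolding pow_q_minus_self[OF assms(1), symmetric] assms(2)
    using assms(1) by (simp add: S.r_right_minus_eq)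
  then have "\<exists>c\<in>h ` carrier R. x \<ominus>\<^bsub>S\<^esub> c = \<zero>\<^bsub>S\<^esub>"
    using finite_R assms(1) by (intro S.finprod_eq_zero_imp) auto
  then show ?thesis
    using assms(1) by (auto simp: S.r_right_minus_eq)
qed

lemma ev_ring_hom:
  assumes "x \<in> carrier S"
  shows "ring_hom_ring (poly_ring R) S (\<lambda>p. ev p x)"
proof -
  interpret UP: domain "poly_ring R"
    by (rule R.univ_poly_is_domain[OF R.carrier_is_subring])
  have car: "set p \<subseteq> carrier R" if "p \<in> carrier (poly_ring R)" for p
    using that by (simp add: univ_poly_carrier[symmetric] R.polynomial_incl)
  have mcar: "set (map h p) \<subseteq> carrier S" if "set p \<subseteq> carrier R" for p
    using that by auto
  have "(\<lambda>p. ev p x) \<in> ring_hom (poly_ring R) S"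
  proof (rule ring_hom_memI)
    fix p r assume pr: "p \<in> carrier (poly_ring R)" "r \<in> carrier (poly_ring R)"
    note c = car[OF pr(1)] car[OF pr(2)]
    have "ev (R.poly_mult p r) x = S.eval (S.normalize (map h (R.poly_mult p r))) x"
      using assms mcar[OF R.poly_mult_in_carrier[OF c]] by (simp add: S.eval_normalize)
    also have "\<dots> = ev p x \<otimes>\<^bsub>S\<^esub> ev r x"
      unfolding poly_mult_hom'[OF c] by (rule S.eval_poly_mult[OF mcar[OF c(1)] mcar[OF c(2)] assms])
    finally show "ev (p \<otimes>\<^bsub>poly_ring R\<^esub> r) x = ev p x \<otimes>\<^bsub>S\<^esub> ev r x"
      by (simp add: univ_poly_mult)
    have "ev (R.poly_add p r) x = S.eval (S.normalize (map h (R.poly_add p r))) x"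
      using assms mcar[OF R.poly_add_in_carrier[OF c]]
      by (simp add: S.eval_normalize del: R.poly_add.simps)
    also have "\<dots> = ev p x \<oplus>\<^bsub>S\<^esub> ev r x"
      unfolding poly_add_hom'[OF c] by (rule S.eval_poly_add[OF mcar[OF c(1)] mcar[OF c(2)] assms])
    finally show "ev (p \<oplus>\<^bsub>poly_ring R\<^esub> r) x = ev p x \<oplus>\<^bsub>S\<^esub> ev r x"
      by (simp add: univ_poly_add)
  qed (use assms car ev_closed in \<open>auto simp: univ_poly_one\<close>)
  then show ?thesis
    using UP.ring_axioms S.ring_axioms by (intro ring_hom_ringI2)
qed


text \<open>The polynomials vanishing at \<open>a\<close> form a proper ideal that contains the maximal ideal generated
  by \<open>P\<close>, so they are the multiples of \<open>P\<close>.\<close>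

lemma mem_PIdl_if_root:
  assumes P: "P \<in> carrier (poly_ring R)" "pirreducible\<^bsub>R\<^esub> (carrier R) P"
    and f: "f \<in> carrier (poly_ring R)"
    and a: "a \<in> carrier S" "ev P a = \<zero>\<^bsub>S\<^esub>" "ev f a = \<zero>\<^bsub>S\<^esub>"
  shows "f \<in> PIdl\<^bsub>poly_ring R\<^esub> P"
proof -
  interpret UP: principal_domain "poly_ring R"
    by (rule R.univ_poly_is_principal[OF R.carrier_is_subfield])
  interpret ev: ring_hom_ring "poly_ring R" S "\<lambda>p. ev p a"
    by (rule ev_ring_hom[OF a(1)])
  interpret I: maximalideal "PIdl\<^bsub>poly_ring R\<^esub> P" "poly_ring R"
    by (rule UP.irreducible_imp_maximalideal[OF P])
  let ?J = "a_kernel (poly_ring R) S (\<lambda>p. ev p a)"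
  have J: "ideal ?J (poly_ring R)"
    by (rule ev.kernel_is_ideal)
  have "P \<in> ?J" "f \<in> ?J"
    unfolding a_kernel_def' using P(1) f a(2,3) by simp_all
  have sub: "PIdl\<^bsub>poly_ring R\<^esub> P \<subseteq> ?J"
    using UP.cgenideal_minimal[OF J \<open>P \<in> ?J\<close>] .
  have "ev \<one>\<^bsub>poly_ring R\<^esub> a \<noteq> \<zero>\<^bsub>S\<^esub>"
    unfolding ev.hom_one by (rule S.one_not_zero)
  then have "?J \<noteq> carrier (poly_ring R)"
    unfolding a_kernel_def' using UP.one_closed by blast
  moreover have "?J \<subseteq> carrier (poly_ring R)"
    unfolding a_kernel_def' by blast
  ultimately have "?J = PIdl\<^bsub>poly_ring R\<^esub> P"
    using I.I_maximal[OF J sub] by blast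
  with \<open>f \<in> ?J\<close> show ?thesis
    by simp
qed

lemma irreducible_length_ge_2:
  assumes P: "P \<in> carrier (poly_ring R)" "pirreducible\<^bsub>R\<^esub> (carrier R) P"
  shows "length P \<ge> 2"
  using R.pirreducible_degree[OF R.carrier_is_subfield P] by simp

text \<open>The $q^d$ elements $\sum_{i<d} c_i a^i$ with $c_i$ in the base field are distinct.\<close>

lemma ev_inj_on_lists:
  assumes P: "P \<in> carrier (poly_ring R)" "pirreducible\<^bsub>R\<^esub> (carrier R) P"
    and a: "a \<in> carrier S" "ev P a = \<zero>\<^bsub>S\<^esub>"
  shows "inj_on (\<lambda>f. ev f a) {f. set f \<subseteq> carrier R \<and> length f = length P - 1}"
proof (rule inj_onI, clarify)
  fix f g
  assume fg: "set f \<subseteq> carrier R" "length f = length P - 1" "set g \<subseteq> carrier R"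
    "length g = length P - 1" "ev f a = ev g a"
  define u where "u = map2 (\<lambda>x y. x \<ominus>\<^bsub>R\<^esub> y) f g"
  have len: "length f = length g"
    using fg by simp
  have u: "set u \<subseteq> carrier R \<and> ev u a = ev f a \<ominus>\<^bsub>S\<^esub> ev g a"
    unfolding u_def using len fg(1,3)
  proof (induction f g rule: list_induct2)
    case Nil
    then show ?case by (simp add: a_minus_def)
  next
    case (Cons x xs y ys)
    have c: "h x \<in> carrier S" "h y \<in> carrier S" "ev xs a \<in> carrier S" "ev ys a \<in> carrier S"
        "x \<in> carrier R" "y \<in> carrier R" "a [^]\<^bsub>S\<^esub> length ys \<in> carrier S"
      using Cons.prems a ev_closed by auto
    define e where "e = a [^]\<^bsub>S\<^esub> length ys"
    have hxy: "h (x \<ominus>\<^bsub>R\<^esub> y) = h x \<ominus>\<^bsub>S\<^esub> h y"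
      using c by (simp add: a_minus_def)
    have "(h x \<ominus>\<^bsub>S\<^esub> h y) \<otimes>\<^bsub>S\<^esub> e \<oplus>\<^bsub>S\<^esub> (ev xs a \<ominus>\<^bsub>S\<^esub> ev ys a) =
        (h x \<otimes>\<^bsub>S\<^esub> e \<oplus>\<^bsub>S\<^esub> ev xs a) \<ominus>\<^bsub>S\<^esub> (h y \<otimes>\<^bsub>S\<^esub> e \<oplus>\<^bsub>S\<^esub> ev ys a)"
      using c(1-4,7) unfolding e_def[symmetric] by algebra
    then show ?case
      using Cons.IH Cons.prems Cons.hyps c(5,6) hxy by (simp add: e_def)
  qed
  let ?v = "R.normalize u"
  have v: "?v \<in> carrier (poly_ring R)"
    using R.normalize_gives_polynomial u by (simp add: univ_poly_carrier)
  have v': "set ?v \<subseteq> carrier R"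
    using u R.normalize_in_carrier by simp
  have "ev u a = \<zero>\<^bsub>S\<^esub>"
    unfolding u[THEN conjunct2] fg(5)
    using S.r_right_minus_eq[OF ev_closed[OF fg(3) a(1)] ev_closed[OF fg(3) a(1)]] by blast
  moreover have ev_norm: "ev (R.normalize w) a = ev w a" if "set w \<subseteq> carrier R" for w
    using that
  proof (induction w)
    case (Cons x xs)
    then show ?case
      using ev_closed[of xs a] a by simp
  qed simp
  ultimately have "ev ?v a = \<zero>\<^bsub>S\<^esub>"
    using u by simp
  then have "?v \<in> PIdl\<^bsub>poly_ring R\<^esub> P"
    using mem_PIdl_if_root[OF P v a] by simp
  then obtain r where "r \<in> carrier (poly_ring R)" "?v = r \<otimes>\<^bsub>poly_ring R\<^esub> P"
    by (auto simp: cgenideal_def)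
  then have "P pdivides\<^bsub>R\<^esub> ?v"
    using R.univ_poly_is_cring[OF R.carrier_is_subring] P(1)
    unfolding pdivides_def factor_def by (metis cring.cring_simprules(14))
  moreover have "length ?v < length P"
    using R.normalize_length_le[of u] fg irreducible_length_ge_2[OF P] by (simp add: u_def)
  ultimately have "?v = []"
    using R.pdivides_imp_degree_le[OF R.carrier_is_subring P(1) v] irreducible_length_ge_2[OF P]
    by (cases ?v) auto
  then have zero: "\<forall>z\<in>set u. z = \<zero>\<^bsub>R\<^esub>"
  proof (induction u)
    case (Cons z u)
    then show ?case by (auto split: if_splits)
  qed simp
  show "f = g"
  proof (rule nth_equalityI[OF len])
    fix i assume i: "i < length f"
    then have "i < length u"
      using len by (simp add: u_def)
    then have "u ! i \<in> set u"
      by (rule nth_mem)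
    moreover have "u ! i = f ! i \<ominus>\<^bsub>R\<^esub> g ! i" "f ! i \<in> carrier R" "g ! i \<in> carrier R"
      using i len fg(1,3) by (auto simp: u_def)
    ultimately show "f ! i = g ! i"
      using bspec[OF zero, of "u ! i"] R.r_right_minus_eq[of "f ! i" "g ! i"] by simp
  qed
qed

text \<open>If $a^{q^m} = a$, then all of the $q^d$ polynomial expressions in $a$ are roots of $y^{q^m} - y$,
  which is impossible for $m < d$.\<close>

lemma root_conjugate_not_fixed:
  assumes P: "P \<in> carrier (poly_ring R)" "pirreducible\<^bsub>R\<^esub> (carrier R) P"
    and a: "a \<in> carrier S" "ev P a = \<zero>\<^bsub>S\<^esub>"
    and m: "0 < m" "m < length P - 1"
  shows "a [^]\<^bsub>S\<^esub> (q ^ m) \<noteq> a"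
proof
  assume fixed: "a [^]\<^bsub>S\<^esub> (q ^ m) = a"
  let ?L = "{f. set f \<subseteq> carrier R \<and> length f = length P - 1}"
  let ?A = "(\<lambda>f. ev f a) ` ?L"
  have "card ?A = q ^ (length P - 1)"
    using card_image[OF ev_inj_on_lists[OF P a]] card_lists_length_eq[OF finite_R] by simp
  moreover have "card ?A \<le> q ^ m"
  proof -
    have "q ^ 1 \<le> q ^ m"
      using q_ge_2 m by (intro power_increasing) auto
    then have "q ^ m \<ge> 2"
      using q_ge_2 by simp
    then obtain p where p: "set p \<subseteq> carrier S" "length p = Suc (q ^ m)" "hd p = \<one>\<^bsub>S\<^esub>"
        "\<forall>y\<in>carrier S. S.eval p y = (y \<oplus>\<^bsub>S\<^esub> \<zero>\<^bsub>S\<^esub>) [^]\<^bsub>S\<^esub> (q ^ m) \<ominus>\<^bsub>S\<^esub> y \<oplus>\<^bsub>S\<^esub> \<zero>\<^bsub>S\<^esub>"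
      using S.monic_shifted_power_diff[OF S.zero_closed S.zero_closed] by blast
    show ?thesis
    proof (rule S.monic_card_roots_le[OF _ _ p(1-3)])
      show "finite ?A"
        using finite_lists_length_eq[OF finite_R] by auto
      show "?A \<subseteq> carrier S"
        using ev_closed a by auto
      fix s assume "s \<in> ?A"
      then obtain f where f: "set f \<subseteq> carrier R" "s = ev f a"
        by auto
      have s: "s \<in> carrier S"
        unfolding f(2) by (rule ev_closed[OF f(1) a(1)])
      have "s [^]\<^bsub>S\<^esub> (q ^ m) = s"
        using ev_pow_q_power[OF f(1) a(1), of m] unfolding fixed f(2) by (rule sym)
      then show "S.eval p s = \<zero>\<^bsub>S\<^esub>"
        using p(4) s by (simp add: S.r_right_minus_eq)
    qed
  qed
  ultimately have "q ^ (length P - 1) \<le> q ^ m"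
    by simp
  moreover have "q ^ m < q ^ (length P - 1)"
    using q_ge_2 m(2) by (intro power_strict_increasing) auto
  ultimately show False
    by simp
qed

lemma root_conjugates_inj:
  assumes P: "P \<in> carrier (poly_ring R)" "pirreducible\<^bsub>R\<^esub> (carrier R) P"
    and a: "a \<in> carrier S" "ev P a = \<zero>\<^bsub>S\<^esub>"
    and ij: "i \<le> j" "j < length P - 1 + i" "a [^]\<^bsub>S\<^esub> (q ^ i) = a [^]\<^bsub>S\<^esub> (q ^ j)"
  shows "i = j"
proof (rule ccontr)
  assume "i \<noteq> j"
  then obtain m where m: "0 < m" "m < length P - 1" "j = m + i"
    using ij by (metis add.commute add_less_cancel_right le_add_diff_inverse le_neq_implies_less zero_less_diff)
  have "(a [^]\<^bsub>S\<^esub> (q ^ m)) [^]\<^bsub>S\<^esub> (q ^ i) = a [^]\<^bsub>S\<^esub> (q ^ i)"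
    using ij(3) a(1) by (simp add: m(3) S.nat_pow_pow power_add)
  then have "a [^]\<^bsub>S\<^esub> (q ^ m) = a"
    by (rule pow_q_power_inj[OF S.nat_pow_closed[OF a(1)] a(1)])
  then show False
    using root_conjugate_not_fixed[OF P a m(1,2)] by simp
qed

text \<open>The polynomial \<open>P\<close> is the product of the linear factors of the conjugates of any one of its roots.\<close>

lemma monic_irreducible_eval:
  assumes P: "P \<in> carrier (poly_ring R)" "pirreducible\<^bsub>R\<^esub> (carrier R) P" "hd P = \<one>\<^bsub>R\<^esub>"
    and a: "a \<in> carrier S" "ev P a = \<zero>\<^bsub>S\<^esub>" and x: "x \<in> carrier S"
  shows "ev P x = (\<Otimes>\<^bsub>S\<^esub>i\<in>{..<length P - 1}. x \<ominus>\<^bsub>S\<^esub> a [^]\<^bsub>S\<^esub> (q ^ i))"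
proof -
  let ?f = "\<lambda>i. a [^]\<^bsub>S\<^esub> (q ^ i)"
  have Pc: "set P \<subseteq> carrier R"
    using P(1) by (simp add: univ_poly_carrier[symmetric] R.polynomial_incl)
  have len: "length P \<ge> 2"
    by (rule irreducible_length_ge_2[OF P(1,2)])
  have inj: "inj_on ?f {..<length P - 1}"
  proof (rule linorder_inj_onI')
    fix i j assume ij: "i \<in> {..<length P - 1}" "j \<in> {..<length P - 1}" "i < j"
    then have "i \<le> j" "j < length P - 1 + i" "i \<noteq> j"
      by auto
    then show "?f i \<noteq> ?f j"
      using root_conjugates_inj[OF P(1,2) a] by blast
  qed
  have "ev P x = (\<Otimes>\<^bsub>S\<^esub>s\<in>?f ` {..<length P - 1}. x \<ominus>\<^bsub>S\<^esub> s)"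
  proof (rule S.monic_eval_eq_finprod)
    show "length (map h P) = Suc (card (?f ` {..<length P - 1}))"
      using len card_image[OF inj] by simp
    show "hd (map h P) = \<one>\<^bsub>S\<^esub>"
      using P(3) len by (cases P) auto
    fix s assume "s \<in> ?f ` {..<length P - 1}"
    then obtain i where "s = ?f i"
      by blast
    then have "ev P s = \<zero>\<^bsub>S\<^esub> [^]\<^bsub>S\<^esub> (q ^ i)"
      using ev_pow_q_power[OF Pc a(1), of i] a(2) by simp
    then show "ev P s = \<zero>\<^bsub>S\<^esub>"
      using q_ge_2 by (simp add: S.nat_pow_zero)
  qed (use a x Pc in auto)
  also have "\<dots> = (\<Otimes>\<^bsub>S\<^esub>i\<in>{..<length P - 1}. x \<ominus>\<^bsub>S\<^esub> ?f i)"
    using inj a x by (intro S.finprod_reindex) auto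
  finally show ?thesis .
qed

lemma root_pow_card:
  assumes P: "P \<in> carrier (poly_ring R)" "pirreducible\<^bsub>R\<^esub> (carrier R) P" "hd P = \<one>\<^bsub>R\<^esub>"
    and a: "a \<in> carrier S" "ev P a = \<zero>\<^bsub>S\<^esub>"
  shows "a [^]\<^bsub>S\<^esub> (q ^ (length P - 1)) = a"
proof -
  let ?d = "length P - 1"
  have Pc: "set P \<subseteq> carrier R"
    using P(1) by (simp add: univ_poly_carrier[symmetric] R.polynomial_incl)
  let ?x = "a [^]\<^bsub>S\<^esub> (q ^ ?d)"
  have x: "?x \<in> carrier S"
    using a by simp
  have "ev P ?x = \<zero>\<^bsub>S\<^esub> [^]\<^bsub>S\<^esub> (q ^ ?d)"
    using ev_pow_q_power[OF Pc a(1), of ?d] unfolding a(2) .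
  then have "ev P ?x = \<zero>\<^bsub>S\<^esub>"
    using q_ge_2 by (simp add: S.nat_pow_zero)
  then have "(\<Otimes>\<^bsub>S\<^esub>i\<in>{..<?d}. ?x \<ominus>\<^bsub>S\<^esub> a [^]\<^bsub>S\<^esub> (q ^ i)) = \<zero>\<^bsub>S\<^esub>"
    using monic_irreducible_eval[OF P a x] by simp
  then have "\<exists>i\<in>{..<?d}. ?x \<ominus>\<^bsub>S\<^esub> a [^]\<^bsub>S\<^esub> (q ^ i) = \<zero>\<^bsub>S\<^esub>"
    by (rule S.finprod_eq_zero_imp[rotated 2]) (use a in auto)
  then obtain i where i: "i < ?d" "?x = a [^]\<^bsub>S\<^esub> (q ^ i)"
    using a by (auto simp: S.r_right_minus_eq)
  show ?thesis
  proof (cases "i = 0")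
    case True
    then show ?thesis
      using i a by simp
  next
    case False
    then have "i = ?d"
      using i by (intro root_conjugates_inj[OF P(1,2) a, of i ?d]) auto
    with i show ?thesis by simp
  qed
qed

end

section \<open>Norms, resultants and reciprocity over a finite field\<close>

lemma (in comm_monoid) finprod_swap:
  assumes "finite A" "finite B" "\<And>i j. i \<in> A \<Longrightarrow> j \<in> B \<Longrightarrow> f i j \<in> carrier G"
  shows "(\<Otimes>i\<in>A. \<Otimes>j\<in>B. f i j) = (\<Otimes>j\<in>B. \<Otimes>i\<in>A. f i j)"
  using assms(1,3)
proof (induction A rule: finite_induct)
  case empty
  then show ?case by simp
next
  case (insert a A)
  have f: "f a \<in> B \<rightarrow> carrier G" "\<And>i. i \<in> A \<Longrightarrow> f i \<in> B \<rightarrow> carrier G"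
    using insert.prems by auto
  have IH: "(\<Otimes>i\<in>A. \<Otimes>j\<in>B. f i j) = (\<Otimes>j\<in>B. \<Otimes>i\<in>A. f i j)"
    using insert.IH insert.prems by blast
  have "(\<Otimes>i\<in>insert a A. \<Otimes>j\<in>B. f i j) = (\<Otimes>j\<in>B. f a j) \<otimes> (\<Otimes>i\<in>A. \<Otimes>j\<in>B. f i j)"
    using insert.hyps f by (intro finprod_insert) (auto intro!: finprod_closed)
  also have "\<dots> = (\<Otimes>j\<in>B. f a j \<otimes> (\<Otimes>i\<in>A. f i j))"
    unfolding IH using f by (intro finprod_multf[symmetric]) (auto intro!: finprod_closed)
  also have "\<dots> = (\<Otimes>j\<in>B. \<Otimes>i\<in>insert a A. f i j)"
    using insert.hyps f
    by (intro finprod_cong' finprod_insert[symmetric]) (auto intro!: finprod_closed)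
  finally show ?case .
qed

lemma (in comm_monoid) finprod_pow_sum:
  assumes "finite A" "x \<in> carrier G"
  shows "(\<Otimes>i\<in>A. x [^] (e i :: nat)) = x [^] (\<Sum>i\<in>A. e i)"
  using assms(1)
proof (induction A rule: finite_induct)
  case (insert a A)
  then have "(\<Otimes>i\<in>insert a A. x [^] e i) = x [^] e a \<otimes> (\<Otimes>i\<in>A. x [^] e i)"
    using assms(2) by (intro finprod_insert) auto
  then show ?case
    using insert assms(2) by (simp add: nat_pow_mult)
qed simp

lemma (in field) monic_irreducible_eq_if_mem_PIdl:
  assumes "P \<in> carrier (poly_ring R)" "pirreducible (carrier R) P" "hd P = \<one>"
    and "Q \<in> carrier (poly_ring R)" "pirreducible (carrier R) Q" "hd Q = \<one>"
    and "Q \<in> PIdl\<^bsub>poly_ring R\<^esub> P"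
  shows "P = Q"
proof -
  have "P \<sim>\<^bsub>poly_ring R\<^esub> Q"
    by (rule cgenideal_pirreducible[OF carrier_is_subfield assms(1,2,5,7)])
  then obtain k where k: "k \<in> carrier R" "P = [k] \<otimes>\<^bsub>poly_ring R\<^esub> Q" "k \<noteq> \<zero>"
    using associated_polynomials_iff[OF carrier_is_subfield assms(1,4)] by auto
  have Q: "polynomial (carrier R) Q" "Q \<noteq> []" "set Q \<subseteq> carrier R"
    using assms(4,5) pirreducibleE(1)[OF carrier_is_subring assms(4,5)]
    by (auto simp: univ_poly_carrier polynomial_in_carrier[OF carrier_is_subring])
  have P: "P = map (\<lambda>b. k \<otimes> b) Q"
    unfolding k(2) univ_poly_mult using k Q by (intro poly_mult_const(1)[OF carrier_is_subring]) auto
  then have "k = \<one>"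
    using assms(3,6) Q(2) k(1) by (cases Q) auto
  moreover have "map (\<lambda>b. \<one> \<otimes> b) Q = Q"
    using Q(3) by (intro map_idI) auto
  ultimately show ?thesis
    using P by simp
qed

text \<open>The exponent $1 + q + \dots + q^{d-1}$ is that of the norm of an extension of degree $d$.\<close>

lemma sum_power_mult_base: "(\<Sum>i<d. q ^ i) * q + 1 = (\<Sum>i<d. q ^ i) + q ^ d" for q :: nat
  by (induction d) (auto simp: algebra_simps)

context finite_field_extension
begin

lemma ev_power_norm_exponent:
  assumes "set f \<subseteq> carrier R" "a \<in> carrier S"
  shows "ev f a [^]\<^bsub>S\<^esub> (\<Sum>i<d. q ^ i) = (\<Otimes>\<^bsub>S\<^esub>i\<in>{..<d}. ev f (a [^]\<^bsub>S\<^esub> (q ^ i)))"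
proof -
  have "(\<Otimes>\<^bsub>S\<^esub>i\<in>{..<d}. ev f (a [^]\<^bsub>S\<^esub> (q ^ i))) = (\<Otimes>\<^bsub>S\<^esub>i\<in>{..<d}. ev f a [^]\<^bsub>S\<^esub> (q ^ i))"
    using assms ev_closed by (intro S.finprod_cong' ev_pow_q_power) auto
  then show ?thesis
    using S.finprod_pow_sum[OF finite_lessThan ev_closed[OF assms]] by simp
qed

lemma norm_in_base:
  assumes "y \<in> carrier S" "y [^]\<^bsub>S\<^esub> (q ^ d) = y" "y \<noteq> \<zero>\<^bsub>S\<^esub>"
  shows "\<exists>r\<in>carrier R. h r = y [^]\<^bsub>S\<^esub> (\<Sum>i<d. q ^ i)"
proof -
  let ?N = "\<Sum>i<d. q ^ i"
  \<comment> \<open>With $N = 1 + q + \dots + q^{d-1}$, the identity $Nq + 1 = N + q^d$ shows that $y^N$ is fixed by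
    the $q$-th power map.\<close>
  have "(y [^]\<^bsub>S\<^esub> ?N) [^]\<^bsub>S\<^esub> q \<otimes>\<^bsub>S\<^esub> y = y [^]\<^bsub>S\<^esub> (?N * q + 1)"
    using assms(1) by (simp add: S.nat_pow_pow S.nat_pow_mult)
  also have "\<dots> = y [^]\<^bsub>S\<^esub> ?N \<otimes>\<^bsub>S\<^esub> y [^]\<^bsub>S\<^esub> (q ^ d)"
    using assms(1) by (simp only: sum_power_mult_base S.nat_pow_mult)
  also have "\<dots> = y [^]\<^bsub>S\<^esub> ?N \<otimes>\<^bsub>S\<^esub> y"
    unfolding assms(2) ..
  finally have "(y [^]\<^bsub>S\<^esub> ?N) [^]\<^bsub>S\<^esub> q = y [^]\<^bsub>S\<^esub> ?N"
    using S.m_rcancel[OF assms(3,1) S.nat_pow_closed[OF S.nat_pow_closed[OF assms(1)]] S.nat_pow_closed[OF assms(1)]]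
    by simp
  then have "y [^]\<^bsub>S\<^esub> ?N \<in> h ` carrier R"
    by (rule pow_q_fixed_imp_base[OF S.nat_pow_closed[OF assms(1)]])
  then show ?thesis
    by (metis imageE)
qed

text \<open>Both sides are double products of the differences of the roots of \<open>P\<close> and \<open>Q\<close>, that is, resultants;
  exchanging the two polynomials changes the sign of each of the $dl$ factors.\<close>

lemma resultant_sign:
  assumes P: "P \<in> carrier (poly_ring R)" "pirreducible\<^bsub>R\<^esub> (carrier R) P" "hd P = \<one>\<^bsub>R\<^esub>"
    and Q: "Q \<in> carrier (poly_ring R)" "pirreducible\<^bsub>R\<^esub> (carrier R) Q" "hd Q = \<one>\<^bsub>R\<^esub>"
    and a: "a \<in> carrier S" "ev P a = \<zero>\<^bsub>S\<^esub>" and b: "b \<in> carrier S" "ev Q b = \<zero>\<^bsub>S\<^esub>"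
  defines "d \<equiv> length P - 1" and "l \<equiv> length Q - 1"
  shows "ev P b [^]\<^bsub>S\<^esub> (\<Sum>j<l. q ^ j) =
    (\<ominus>\<^bsub>S\<^esub> \<one>\<^bsub>S\<^esub>) [^]\<^bsub>S\<^esub> (d * l) \<otimes>\<^bsub>S\<^esub> ev Q a [^]\<^bsub>S\<^esub> (\<Sum>i<d. q ^ i)"
proof -
  have c: "set P \<subseteq> carrier R" "set Q \<subseteq> carrier R"
    using P(1) Q(1) by (simp_all add: univ_poly_carrier[symmetric] R.polynomial_incl)
  define A where "A i = a [^]\<^bsub>S\<^esub> (q ^ i)" for i
  define B where "B j = b [^]\<^bsub>S\<^esub> (q ^ j)" for j
  have AB: "A i \<in> carrier S" "B i \<in> carrier S" for i
    using a b by (auto simp: A_def B_def)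
  let ?n = "\<ominus>\<^bsub>S\<^esub> \<one>\<^bsub>S\<^esub>"
  have n: "?n \<in> carrier S"
    by simp
  have flip: "B j \<ominus>\<^bsub>S\<^esub> A i = ?n \<otimes>\<^bsub>S\<^esub> (A i \<ominus>\<^bsub>S\<^esub> B j)" for i j
    using AB[of i] AB[of j] by algebra
  have d1: "(\<Otimes>\<^bsub>S\<^esub>i\<in>{..<d}. A i \<ominus>\<^bsub>S\<^esub> B j) \<in> carrier S" for j
    using AB by (intro S.finprod_closed) auto
  have "ev P b [^]\<^bsub>S\<^esub> (\<Sum>j<l. q ^ j) = (\<Otimes>\<^bsub>S\<^esub>j\<in>{..<l}. ev P (B j))"
    unfolding B_def by (rule ev_power_norm_exponent[OF c(1) b(1)])
  also have "\<dots> = (\<Otimes>\<^bsub>S\<^esub>j\<in>{..<l}. \<Otimes>\<^bsub>S\<^esub>i\<in>{..<d}. B j \<ominus>\<^bsub>S\<^esub> A i)"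
    using monic_irreducible_eval[OF P a AB(2)] by (simp add: A_def d_def)
  also have "\<dots> = (\<Otimes>\<^bsub>S\<^esub>j\<in>{..<l}. ?n [^]\<^bsub>S\<^esub> d \<otimes>\<^bsub>S\<^esub> (\<Otimes>\<^bsub>S\<^esub>i\<in>{..<d}. A i \<ominus>\<^bsub>S\<^esub> B j))"
  proof (rule S.finprod_cong')
    fix j
    have "(\<Otimes>\<^bsub>S\<^esub>i\<in>{..<d}. B j \<ominus>\<^bsub>S\<^esub> A i) = (\<Otimes>\<^bsub>S\<^esub>i\<in>{..<d}. ?n \<otimes>\<^bsub>S\<^esub> (A i \<ominus>\<^bsub>S\<^esub> B j))"
      unfolding flip ..
    also have "\<dots> = (\<Otimes>\<^bsub>S\<^esub>i\<in>{..<d}. ?n) \<otimes>\<^bsub>S\<^esub> (\<Otimes>\<^bsub>S\<^esub>i\<in>{..<d}. A i \<ominus>\<^bsub>S\<^esub> B j)"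
      using AB by (intro S.finprod_multf) auto
    finally show "(\<Otimes>\<^bsub>S\<^esub>i\<in>{..<d}. B j \<ominus>\<^bsub>S\<^esub> A i) =
        ?n [^]\<^bsub>S\<^esub> d \<otimes>\<^bsub>S\<^esub> (\<Otimes>\<^bsub>S\<^esub>i\<in>{..<d}. A i \<ominus>\<^bsub>S\<^esub> B j)"
      unfolding S.finprod_const[OF n] card_lessThan .
  qed (use d1 in auto)
  also have "\<dots> = (\<Otimes>\<^bsub>S\<^esub>j\<in>{..<l}. ?n [^]\<^bsub>S\<^esub> d) \<otimes>\<^bsub>S\<^esub> (\<Otimes>\<^bsub>S\<^esub>j\<in>{..<l}. \<Otimes>\<^bsub>S\<^esub>i\<in>{..<d}. A i \<ominus>\<^bsub>S\<^esub> B j)"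
    using d1 by (intro S.finprod_multf) auto
  also have "(\<Otimes>\<^bsub>S\<^esub>j\<in>{..<l}. ?n [^]\<^bsub>S\<^esub> d) = ?n [^]\<^bsub>S\<^esub> (d * l)"
    unfolding S.finprod_const[OF S.nat_pow_closed[OF n]] card_lessThan S.nat_pow_pow[OF n] ..
  also have "(\<Otimes>\<^bsub>S\<^esub>j\<in>{..<l}. \<Otimes>\<^bsub>S\<^esub>i\<in>{..<d}. A i \<ominus>\<^bsub>S\<^esub> B j) = (\<Otimes>\<^bsub>S\<^esub>i\<in>{..<d}. \<Otimes>\<^bsub>S\<^esub>j\<in>{..<l}. A i \<ominus>\<^bsub>S\<^esub> B j)"
    using AB by (intro S.finprod_swap) auto
  also have "\<dots> = (\<Otimes>\<^bsub>S\<^esub>i\<in>{..<d}. ev Q (A i))"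
    using monic_irreducible_eval[OF Q b AB(1)] by (simp add: B_def l_def)
  also have "\<dots> = ev Q a [^]\<^bsub>S\<^esub> (\<Sum>i<d. q ^ i)"
    unfolding A_def by (rule ev_power_norm_exponent[OF c(2) a(1), symmetric])
  finally show ?thesis .
qed

lemma power_minus_const_in_PIdl:
  fixes e m :: nat
  assumes P: "P \<in> carrier (poly_ring R)" "pirreducible\<^bsub>R\<^esub> (carrier R) P"
    and Q: "Q \<in> carrier (poly_ring R)"
    and a: "a \<in> carrier S" "ev P a = \<zero>\<^bsub>S\<^esub>"
    and r: "r \<in> carrier R" "h r = ev Q a [^]\<^bsub>S\<^esub> e"
  shows "Q [^]\<^bsub>poly_ring R\<^esub> (e * m) \<ominus>\<^bsub>poly_ring R\<^esub> R.poly_of_const (r [^]\<^bsub>R\<^esub> m) \<in> PIdl\<^bsub>poly_ring R\<^esub> P"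
proof -
  interpret ev: ring_hom_ring "poly_ring R" S "\<lambda>p. ev p a"
    by (rule ev_ring_hom[OF a(1)])
  let ?r = "r [^]\<^bsub>R\<^esub> m" and ?X = "Q [^]\<^bsub>poly_ring R\<^esub> (e * m)"
  have rm: "?r \<in> carrier R" "R.poly_of_const ?r \<in> carrier (poly_ring R)"
    using r(1) R.normalize_gives_polynomial[of "[?r]" "carrier R"]
    by (simp_all add: R.poly_of_const_def univ_poly_carrier)
  have X: "?X \<in> carrier (poly_ring R)"
    by (rule ev.R.nat_pow_closed[OF Q])
  have Qa: "ev Q a \<in> carrier S"
    by (rule ev.hom_closed[OF Q])
  have c: "ev (R.poly_of_const ?r) a = h ?r"
    using rm(1) by (auto simp: R.poly_of_const_def)
  have hr: "h ?r = ev ?X a"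
  proof -
    have "h ?r = (ev Q a [^]\<^bsub>S\<^esub> e) [^]\<^bsub>S\<^esub> m"
      unfolding hom_nat_pow[OF r(1)] r(2) ..
    also have "\<dots> = ev Q a [^]\<^bsub>S\<^esub> (e * m)"
      by (rule S.nat_pow_pow[OF Qa])
    also have "\<dots> = ev ?X a"
      by (rule ev.hom_nat_pow[OF Q, symmetric])
    finally show ?thesis .
  qed
  have nc: "\<ominus>\<^bsub>poly_ring R\<^esub> R.poly_of_const ?r \<in> carrier (poly_ring R)"
    by (rule ev.R.a_inv_closed[OF rm(2)])
  have "ev (?X \<ominus>\<^bsub>poly_ring R\<^esub> R.poly_of_const ?r) a = ev ?X a \<oplus>\<^bsub>S\<^esub> \<ominus>\<^bsub>S\<^esub> h ?r"
    unfolding a_minus_def ev.hom_add[OF X nc] ev.hom_a_inv[OF rm(2)] c ..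
  also have "\<dots> = \<zero>\<^bsub>S\<^esub>"
    unfolding hr by (rule S.r_neg[OF ev.hom_closed[OF X]])
  finally show ?thesis
    using mem_PIdl_if_root[OF P ev.R.minus_closed[OF X rm(2)] a] by simp
qed

end

text \<open>The element \<open>r\<close> is the resultant of \<open>P\<close> and \<open>Q\<close>. The factor \<open>m\<close> in the exponents stands for
  $(q - 1)/n$.\<close>

theorem finite_field_power_reciprocity:
  fixes R (structure)
  assumes R: "field R" "finite (carrier R)"
    and P: "P \<in> carrier (poly_ring R)" "pirreducible (carrier R) P" "hd P = \<one>"
    and Q: "Q \<in> carrier (poly_ring R)" "pirreducible (carrier R) Q" "hd Q = \<one>"
    and "P \<noteq> Q"
  defines "q \<equiv> card (carrier R)" and "d \<equiv> length P - 1" and "l \<equiv> length Q - 1"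
  shows "\<exists>r\<in>carrier R - {\<zero>}. \<forall>m::nat.
      Q [^]\<^bsub>poly_ring R\<^esub> ((\<Sum>i<d. q ^ i) * m) \<ominus>\<^bsub>poly_ring R\<^esub> ring.poly_of_const R (r [^] m)
        \<in> PIdl\<^bsub>poly_ring R\<^esub> P \<and>
      P [^]\<^bsub>poly_ring R\<^esub> ((\<Sum>i<l. q ^ i) * m) \<ominus>\<^bsub>poly_ring R\<^esub>
        ring.poly_of_const R (((\<ominus> \<one>) [^] (d * l) \<otimes> r) [^] m) \<in> PIdl\<^bsub>poly_ring R\<^esub> Q"
proof -
  interpret R: field R
    by fact
  \<comment> \<open>Any extension field containing roots of both polynomials would do.\<close>
  obtain S :: "(('a list \<times> nat) multiset \<Rightarrow> 'a) ring"
    where S: "algebraic_closure S (R.indexed_const ` carrier R)" "R.indexed_const \<in> ring_hom R S"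
    by (rule R.exists_closure)
  let ?h = R.indexed_const
  interpret S: algebraic_closure S "?h ` carrier R"
    by fact
  interpret finite_field_extension R S ?h
    by (unfold_locales; use S(2) R in auto)
  have root: "\<exists>a\<in>carrier S. ev f a = \<zero>\<^bsub>S\<^esub>"
    if f: "f \<in> carrier (poly_ring R)" "pirreducible (carrier R) f" for f
  proof -
    have hf: "map ?h f \<in> carrier (poly_ring S)"
      by (rule polynomial_hom[OF S(2) R.field_axioms S.field_axioms f(1)])
    have "degree (map ?h f) \<ge> 1"
      using irreducible_length_ge_2[OF f] by simp
    then have "S.roots (map ?h f) \<noteq> {#}"
      using S.roots_over_carrier[OF hf] unfolding S.splitted_def by auto
    then obtain a where "a \<in># S.roots (map ?h f)"
      by auto
    then have "S.is_root (map ?h f) a"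
      using S.roots_mem_iff_is_root[OF hf] by simp
    then show ?thesis
      unfolding S.is_root_def by auto
  qed
  obtain a b where a: "a \<in> carrier S" "ev P a = \<zero>\<^bsub>S\<^esub>" and b: "b \<in> carrier S" "ev Q b = \<zero>\<^bsub>S\<^esub>"
    using root[OF P(1,2)] root[OF Q(1,2)] by blast
  have c: "set P \<subseteq> carrier R" "set Q \<subseteq> carrier R"
    using P(1) Q(1) by (simp_all add: univ_poly_carrier[symmetric] R.polynomial_incl)
  have Qa: "ev Q a \<noteq> \<zero>\<^bsub>S\<^esub>"
    using mem_PIdl_if_root[OF P(1,2) Q(1) a] R.monic_irreducible_eq_if_mem_PIdl[OF P Q] \<open>P \<noteq> Q\<close> by blast
  have Qc: "ev Q a \<in> carrier S"
    by (rule ev_closed[OF c(2) a(1)])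
  have "ev Q a [^]\<^bsub>S\<^esub> (q ^ d) = ev Q a"
    using ev_pow_q_power[OF c(2) a(1), of d] root_pow_card[OF P a] by (simp add: q_def d_def)
  then obtain r where r: "r \<in> carrier R" "?h r = ev Q a [^]\<^bsub>S\<^esub> (\<Sum>i<d. q ^ i)"
    using norm_in_base[OF Qc _ Qa, of d] unfolding q_def by blast
  have "r \<noteq> \<zero>"
  proof
    assume "r = \<zero>"
    then have "ev Q a [^]\<^bsub>S\<^esub> (\<Sum>i<d. q ^ i) = \<zero>\<^bsub>S\<^esub>"
      using r(2) hom_zero by simp
    then show False
      using S.pow_eq_zero_imp[OF Qc] Qa by blast
  qed
  let ?r = "(\<ominus> \<one>) [^] (d * l) \<otimes> r"
  have n: "\<ominus> \<one> \<in> carrier R"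
    by simp
  have r': "?r \<in> carrier R"
    using r(1) by simp
  have hr': "?h ?r = ev P b [^]\<^bsub>S\<^esub> (\<Sum>j<l. q ^ j)"
    unfolding resultant_sign[OF P Q a b, folded q_def d_def l_def]
      hom_mult[OF R.nat_pow_closed[OF n] r(1)] hom_nat_pow[OF n] hom_a_inv[OF R.one_closed] hom_one r(2) ..
  show ?thesis
    using power_minus_const_in_PIdl[OF P(1,2) Q(1) a r] power_minus_const_in_PIdl[OF Q(1,2) P(1) b r' hr']
      r(1) \<open>r \<noteq> \<zero>\<close> by blast
qed

section \<open>Ultraproducts of rings and fields\<close>

lemma carrier_ultraproduct_ring:
  "carrier (ultraproduct_ring D R) = ultraproduct D (\<lambda>s. carrier (R s))"
  by (simp add: ultraproduct_ring_def)

lemma ultraproduct_ring_one: "\<one>\<^bsub>ultraproduct_ring D R\<^esub> = ulim D (\<lambda>s. \<one>\<^bsub>R s\<^esub>)"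
  by (simp add: ultraproduct_ring_def)

lemma ultraproduct_ring_zero: "\<zero>\<^bsub>ultraproduct_ring D R\<^esub> = ulim D (\<lambda>s. \<zero>\<^bsub>R s\<^esub>)"
  by (simp add: ultraproduct_ring_def)

lemma ulim_in_carrier:
  "\<forall>\<^sub>F s in D. a s \<in> carrier (R s) \<Longrightarrow> ulim D a \<in> carrier (ultraproduct_ring D R)"
  by (simp add: carrier_ultraproduct_ring ultraproduct_def)

lemma ultraproduct_ringE:
  assumes "x \<in> carrier (ultraproduct_ring D R)"
  obtains a where "x = ulim D a" "\<forall>\<^sub>F s in D. a s \<in> carrier (R s)"
  using assms by (auto simp: carrier_ultraproduct_ring ultraproduct_def)

lemma ulim_urep_carrier:
  "x \<in> carrier (ultraproduct_ring D R) \<Longrightarrow> ulim D (urep x) = x"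
  unfolding carrier_ultraproduct_ring by (rule ulim_urep)

lemma eventually_urep_carrier:
  assumes "x \<in> carrier (ultraproduct_ring D R)"
  shows "\<forall>\<^sub>F s in D. urep x s \<in> carrier (R s)"
proof -
  obtain a where a: "x = ulim D a" "\<forall>\<^sub>F s in D. a s \<in> carrier (R s)"
    using assms by (rule ultraproduct_ringE)
  show ?thesis
    using urep_ulim[of D a] a(2) unfolding a(1) by eventually_elim simp
qed

lemma ulim_in_carrier_iff:
  "ulim D a \<in> carrier (ultraproduct_ring D R) \<longleftrightarrow> (\<forall>\<^sub>F s in D. a s \<in> carrier (R s))"
proof
  assume "ulim D a \<in> carrier (ultraproduct_ring D R)"
  then have "\<forall>\<^sub>F s in D. urep (ulim D a) s \<in> carrier (R s)"
    by (rule eventually_urep_carrier)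
  then show "\<forall>\<^sub>F s in D. a s \<in> carrier (R s)"
    using urep_ulim[of D a] by eventually_elim simp
qed (rule ulim_in_carrier)

lemma ultraproduct_ring_pow:
  fixes k :: nat
  shows "ulim D a [^]\<^bsub>ultraproduct_ring D R\<^esub> k = ulim D (\<lambda>s. a s [^]\<^bsub>R s\<^esub> k)"
  by (induction k) (simp_all add: ultraproduct_ring_one ultraproduct_ring_mult)

lemma ring_ultraproduct_ring:
  assumes R: "\<forall>\<^sub>F s in D. ring (R s)"
  shows "ring (ultraproduct_ring D R)"
proof (intro ringI abelian_groupI monoidI)
  let ?U = "ultraproduct_ring D R"
  fix x y z assume xyz: "x \<in> carrier ?U" "y \<in> carrier ?U" "z \<in> carrier ?U"
  obtain a where a: "x = ulim D a" "\<forall>\<^sub>F s in D. a s \<in> carrier (R s)"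
    using xyz(1) by (rule ultraproduct_ringE)
  obtain b where b: "y = ulim D b" "\<forall>\<^sub>F s in D. b s \<in> carrier (R s)"
    using xyz(2) by (rule ultraproduct_ringE)
  obtain c where c: "z = ulim D c" "\<forall>\<^sub>F s in D. c s \<in> carrier (R s)"
    using xyz(3) by (rule ultraproduct_ringE)
  show "x \<oplus>\<^bsub>?U\<^esub> y \<oplus>\<^bsub>?U\<^esub> z = x \<oplus>\<^bsub>?U\<^esub> (y \<oplus>\<^bsub>?U\<^esub> z)"
    unfolding a(1) b(1) c(1) ultraproduct_ring_add ulim_eq_iff
    using R a(2) b(2) c(2) by eventually_elim (simp add: ring.ring_simprules)
  show "x \<otimes>\<^bsub>?U\<^esub> y \<otimes>\<^bsub>?U\<^esub> z = x \<otimes>\<^bsub>?U\<^esub> (y \<otimes>\<^bsub>?U\<^esub> z)"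
    unfolding a(1) b(1) c(1) ultraproduct_ring_mult ulim_eq_iff
    using R a(2) b(2) c(2) by eventually_elim (simp add: ring.ring_simprules)
  show "(x \<oplus>\<^bsub>?U\<^esub> y) \<otimes>\<^bsub>?U\<^esub> z = x \<otimes>\<^bsub>?U\<^esub> z \<oplus>\<^bsub>?U\<^esub> y \<otimes>\<^bsub>?U\<^esub> z"
    unfolding a(1) b(1) c(1) ultraproduct_ring_mult ultraproduct_ring_add ulim_eq_iff
    using R a(2) b(2) c(2) by eventually_elim (simp add: ring.ring_simprules)
  show "z \<otimes>\<^bsub>?U\<^esub> (x \<oplus>\<^bsub>?U\<^esub> y) = z \<otimes>\<^bsub>?U\<^esub> x \<oplus>\<^bsub>?U\<^esub> z \<otimes>\<^bsub>?U\<^esub> y"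
    unfolding a(1) b(1) c(1) ultraproduct_ring_mult ultraproduct_ring_add ulim_eq_iff
    using R a(2) b(2) c(2) by eventually_elim (simp add: ring.ring_simprules)
next
  let ?U = "ultraproduct_ring D R"
  fix x y assume xy: "x \<in> carrier ?U" "y \<in> carrier ?U"
  obtain a where a: "x = ulim D a" "\<forall>\<^sub>F s in D. a s \<in> carrier (R s)"
    using xy(1) by (rule ultraproduct_ringE)
  obtain b where b: "y = ulim D b" "\<forall>\<^sub>F s in D. b s \<in> carrier (R s)"
    using xy(2) by (rule ultraproduct_ringE)
  show "x \<oplus>\<^bsub>?U\<^esub> y \<in> carrier ?U"
    unfolding a(1) b(1) ultraproduct_ring_add ulim_in_carrier_iff
    using R a(2) b(2) by eventually_elim (simp add: ring.ring_simprules)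
  show "x \<otimes>\<^bsub>?U\<^esub> y \<in> carrier ?U"
    unfolding a(1) b(1) ultraproduct_ring_mult ulim_in_carrier_iff
    using R a(2) b(2) by eventually_elim (simp add: ring.ring_simprules)
  show "x \<oplus>\<^bsub>?U\<^esub> y = y \<oplus>\<^bsub>?U\<^esub> x"
    unfolding a(1) b(1) ultraproduct_ring_add ulim_eq_iff
    using R a(2) b(2) by eventually_elim (simp add: ring.ring_simprules)
next
  let ?U = "ultraproduct_ring D R"
  fix x assume x: "x \<in> carrier ?U"
  obtain a where a: "x = ulim D a" "\<forall>\<^sub>F s in D. a s \<in> carrier (R s)"
    using x by (rule ultraproduct_ringE)
  show "\<zero>\<^bsub>?U\<^esub> \<oplus>\<^bsub>?U\<^esub> x = x"
    unfolding a(1) ultraproduct_ring_add ultraproduct_ring_zero ulim_eq_iff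
    using R a(2) by eventually_elim (simp add: ring.ring_simprules)
  show "\<one>\<^bsub>?U\<^esub> \<otimes>\<^bsub>?U\<^esub> x = x"
    unfolding a(1) ultraproduct_ring_mult ultraproduct_ring_one ulim_eq_iff
    using R a(2) by eventually_elim (simp add: ring.ring_simprules)
  show "x \<otimes>\<^bsub>?U\<^esub> \<one>\<^bsub>?U\<^esub> = x"
    unfolding a(1) ultraproduct_ring_mult ultraproduct_ring_one ulim_eq_iff
    using R a(2) by eventually_elim (simp add: monoid.r_one[OF ring.is_monoid])
  have "ulim D (\<lambda>s. \<ominus>\<^bsub>R s\<^esub> a s) \<in> carrier ?U"
    unfolding ulim_in_carrier_iff using R a(2) by eventually_elim (simp add: ring.ring_simprules)
  moreover have "ulim D (\<lambda>s. \<ominus>\<^bsub>R s\<^esub> a s) \<oplus>\<^bsub>?U\<^esub> x = \<zero>\<^bsub>?U\<^esub>"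
    unfolding a(1) ultraproduct_ring_add ultraproduct_ring_zero ulim_eq_iff
    using R a(2) by eventually_elim (simp add: ring.ring_simprules)
  ultimately show "\<exists>y\<in>carrier ?U. y \<oplus>\<^bsub>?U\<^esub> x = \<zero>\<^bsub>?U\<^esub>"
    by blast
next
  show "\<zero>\<^bsub>ultraproduct_ring D R\<^esub> \<in> carrier (ultraproduct_ring D R)"
    unfolding ultraproduct_ring_zero ulim_in_carrier_iff
    using R by eventually_elim (simp add: ring.ring_simprules)
  show "\<one>\<^bsub>ultraproduct_ring D R\<^esub> \<in> carrier (ultraproduct_ring D R)"
    unfolding ultraproduct_ring_one ulim_in_carrier_iff
    using R by eventually_elim (simp add: ring.ring_simprules)
qed

lemma ultraproduct_ring_a_inv:
  assumes R: "\<forall>\<^sub>F s in D. ring (R s)" and a: "\<forall>\<^sub>F s in D. a s \<in> carrier (R s)"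
  shows "\<ominus>\<^bsub>ultraproduct_ring D R\<^esub> ulim D a = ulim D (\<lambda>s. \<ominus>\<^bsub>R s\<^esub> a s)"
proof -
  let ?U = "ultraproduct_ring D R"
  interpret U: ring ?U
    by (rule ring_ultraproduct_ring[OF R])
  have sum: "ulim D (\<lambda>s. \<ominus>\<^bsub>R s\<^esub> a s) \<oplus>\<^bsub>?U\<^esub> ulim D a = \<zero>\<^bsub>?U\<^esub>"
    unfolding ultraproduct_ring_add ultraproduct_ring_zero ulim_eq_iff
    using R a by eventually_elim (simp add: ring.ring_simprules)
  have "ulim D (\<lambda>s. \<ominus>\<^bsub>R s\<^esub> a s) \<in> carrier ?U"
    unfolding ulim_in_carrier_iff using R a by eventually_elim (simp add: ring.ring_simprules)
  then show ?thesis
    by (rule U.minus_equality[OF sum ulim_in_carrier[OF a]])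
qed

lemma ultraproduct_ring_minus:
  assumes R: "\<forall>\<^sub>F s in D. ring (R s)" and b: "\<forall>\<^sub>F s in D. b s \<in> carrier (R s)"
  shows "ulim D a \<ominus>\<^bsub>ultraproduct_ring D R\<^esub> ulim D b = ulim D (\<lambda>s. a s \<ominus>\<^bsub>R s\<^esub> b s)"
  unfolding a_minus_def ultraproduct_ring_a_inv[OF assms] ultraproduct_ring_add ..

text \<open>Congruence modulo a principal ideal holds in the ultraproduct if and only if it holds almost
  everywhere; the cofactors at the single indices are collected by choice.\<close>

lemma ulim_mem_PIdl_iff:
  "ulim D x \<in> PIdl\<^bsub>ultraproduct_ring D R\<^esub> (ulim D p) \<longleftrightarrow> (\<forall>\<^sub>F s in D. x s \<in> PIdl\<^bsub>R s\<^esub> (p s))"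
proof
  assume "ulim D x \<in> PIdl\<^bsub>ultraproduct_ring D R\<^esub> (ulim D p)"
  then obtain y where y: "y \<in> carrier (ultraproduct_ring D R)"
      "ulim D x = y \<otimes>\<^bsub>ultraproduct_ring D R\<^esub> ulim D p"
    by (auto simp: cgenideal_def)
  obtain b where b: "y = ulim D b" "\<forall>\<^sub>F s in D. b s \<in> carrier (R s)"
    using y(1) by (rule ultraproduct_ringE)
  have "\<forall>\<^sub>F s in D. x s = b s \<otimes>\<^bsub>R s\<^esub> p s"
    using y(2) unfolding b(1) ultraproduct_ring_mult ulim_eq_iff .
  then show "\<forall>\<^sub>F s in D. x s \<in> PIdl\<^bsub>R s\<^esub> (p s)"
    using b(2) by eventually_elim (auto simp: cgenideal_def)
next
  assume "\<forall>\<^sub>F s in D. x s \<in> PIdl\<^bsub>R s\<^esub> (p s)"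
  then have "\<forall>\<^sub>F s in D. \<exists>y. y \<in> carrier (R s) \<and> x s = y \<otimes>\<^bsub>R s\<^esub> p s"
    by eventually_elim (auto simp: cgenideal_def)
  then obtain y where y: "\<forall>\<^sub>F s in D. y s \<in> carrier (R s) \<and> x s = y s \<otimes>\<^bsub>R s\<^esub> p s"
    unfolding eventually_ex by blast
  then have "ulim D y \<in> carrier (ultraproduct_ring D R)"
    unfolding ulim_in_carrier_iff by eventually_elim simp
  moreover have "ulim D x = ulim D y \<otimes>\<^bsub>ultraproduct_ring D R\<^esub> ulim D p"
    unfolding ultraproduct_ring_mult ulim_eq_iff using y by eventually_elim simp
  ultimately show "ulim D x \<in> PIdl\<^bsub>ultraproduct_ring D R\<^esub> (ulim D p)"
    unfolding cgenideal_def by blast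
qed

text \<open>Ultrafilters, possibly principal. The second axiom is the dichotomy between a set and its
  complement.\<close>

locale ultrafilter =
  fixes D :: "'s filter"
  assumes not_bot: "D \<noteq> bot"
    and ultra: "eventually P D \<or> eventually (\<lambda>s. \<not> P s) D"
begin

lemma not_eventually_iff: "\<not> eventually P D \<longleftrightarrow> eventually (\<lambda>s. \<not> P s) D"
  using ultra[of P] not_bot eventually_conj[of P D "\<lambda>s. \<not> P s"]
  by (auto simp: eventually_False)

text \<open>If almost everywhere one of finitely many cases holds, then one case holds almost everywhere.\<close>

lemma eventually_bex_finite:
  assumes "finite I" "\<forall>\<^sub>F s in D. \<exists>i\<in>I. P i s"
  shows "\<exists>i\<in>I. \<forall>\<^sub>F s in D. P i s"
proof (rule ccontr)
  assume "\<not> ?thesis"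
  then have "\<forall>i\<in>I. \<forall>\<^sub>F s in D. \<not> P i s"
    by (simp add: not_eventually_iff)
  then have "\<forall>\<^sub>F s in D. \<forall>i\<in>I. \<not> P i s"
    using assms(1) by (simp add: eventually_ball_finite_distrib)
  then have "\<forall>\<^sub>F s in D. \<not> (\<exists>i\<in>I. P i s)"
    by eventually_elim blast
  then show False
    using assms(2) not_eventually_iff by blast
qed

lemma field_ultraproduct_ring:
  assumes K: "\<forall>\<^sub>F s in D. field (K s)"
  shows "field (ultraproduct_ring D K)"
proof -
  let ?F = "ultraproduct_ring D K"
  have R: "\<forall>\<^sub>F s in D. ring (K s)"
    using K by eventually_elim (simp add: field.is_ring)
  interpret F: ring ?F
    by (rule ring_ultraproduct_ring[OF R])
  have comm: "x \<otimes>\<^bsub>?F\<^esub> y = y \<otimes>\<^bsub>?F\<^esub> x" if xy: "x \<in> carrier ?F" "y \<in> carrier ?F" for x y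
  proof -
    obtain a where a: "x = ulim D a" "\<forall>\<^sub>F s in D. a s \<in> carrier (K s)"
      using xy(1) by (rule ultraproduct_ringE)
    obtain b where b: "y = ulim D b" "\<forall>\<^sub>F s in D. b s \<in> carrier (K s)"
      using xy(2) by (rule ultraproduct_ringE)
    show ?thesis
      unfolding a(1) b(1) ultraproduct_ring_mult ulim_eq_iff
      using K a(2) b(2)
    proof eventually_elim
      case (elim s)
      then interpret field "K s" by simp
      show ?case using elim m_comm by simp
    qed
  qed
  have "comm_monoid ?F"
    using comm by (intro F.monoid_comm_monoidI)
  then interpret F: cring ?F
    using F.ring_axioms by (intro cring.intro)
  show ?thesis
  proof (rule F.cring_fieldI2)
    have "\<not> (\<forall>\<^sub>F s in D. \<zero>\<^bsub>K s\<^esub> = \<one>\<^bsub>K s\<^esub>)"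
      unfolding not_eventually_iff using K
    proof eventually_elim
      case (elim s)
      then interpret field "K s" .
      show ?case using one_not_zero by simp
    qed
    then show "\<zero>\<^bsub>?F\<^esub> \<noteq> \<one>\<^bsub>?F\<^esub>"
      unfolding ultraproduct_ring_one ultraproduct_ring_zero ulim_eq_iff .
  next
    fix x assume x: "x \<in> carrier ?F" "x \<noteq> \<zero>\<^bsub>?F\<^esub>"
    obtain a where a: "x = ulim D a" "\<forall>\<^sub>F s in D. a s \<in> carrier (K s)"
      using x(1) by (rule ultraproduct_ringE)
    have "\<forall>\<^sub>F s in D. a s \<noteq> \<zero>\<^bsub>K s\<^esub>"
      using x(2) unfolding a(1) ultraproduct_ring_zero ulim_eq_iff not_eventually_iff .
    then have "\<forall>\<^sub>F s in D. inv\<^bsub>K s\<^esub> (a s) \<in> carrier (K s) \<and> a s \<otimes>\<^bsub>K s\<^esub> inv\<^bsub>K s\<^esub> (a s) = \<one>\<^bsub>K s\<^esub>"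
      using K a(2)
    proof eventually_elim
      case (elim s)
      then interpret field "K s" by simp
      show ?case using elim field_Units by simp
    qed
    then have "ulim D (\<lambda>s. inv\<^bsub>K s\<^esub> (a s)) \<in> carrier ?F"
        "x \<otimes>\<^bsub>?F\<^esub> ulim D (\<lambda>s. inv\<^bsub>K s\<^esub> (a s)) = \<one>\<^bsub>?F\<^esub>"
      unfolding a(1) ultraproduct_ring_mult ultraproduct_ring_one ulim_eq_iff ulim_in_carrier_iff
      by (eventually_elim, simp)+
    then show "\<exists>y\<in>carrier ?F. x \<otimes>\<^bsub>?F\<^esub> y = \<one>\<^bsub>?F\<^esub>"
      by blast
  qed
qed

end

section \<open>Polynomials over an ultraproduct\<close>

text \<open>The polynomial at the index \<open>s\<close> of a polynomial with coefficients in an ultraproduct, given by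
  representatives of the coefficients. Its leading coefficient may vanish on a null set of indices,
  since no normalization is applied.\<close>

definition coordinate_poly :: "('s \<Rightarrow> 'a) set list \<Rightarrow> 's \<Rightarrow> 'a list" where
  "coordinate_poly p s = map (\<lambda>c. urep c s) p"

lemma length_coordinate_poly [simp]: "length (coordinate_poly p s) = length p"
  by (simp add: coordinate_poly_def)

lemma eventually_urep_add:
  "\<forall>\<^sub>F s in D. urep (x \<oplus>\<^bsub>ultraproduct_ring D R\<^esub> y) s = urep x s \<oplus>\<^bsub>R s\<^esub> urep y s"
  using urep_ulim[of D "\<lambda>s. urep x s \<oplus>\<^bsub>R s\<^esub> urep y s"] by (simp add: ultraproduct_ring_def)

lemma eventually_urep_mult:
  "\<forall>\<^sub>F s in D. urep (x \<otimes>\<^bsub>ultraproduct_ring D R\<^esub> y) s = urep x s \<otimes>\<^bsub>R s\<^esub> urep y s"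
  using urep_ulim[of D "\<lambda>s. urep x s \<otimes>\<^bsub>R s\<^esub> urep y s"] by (simp add: ultraproduct_ring_def)

lemma eventually_urep_zero:
  "\<forall>\<^sub>F s in D. urep \<zero>\<^bsub>ultraproduct_ring D R\<^esub> s = \<zero>\<^bsub>R s\<^esub>"
  unfolding ultraproduct_ring_zero by (rule urep_ulim)

lemma eventually_coordinate_poly_carrier:
  assumes "set p \<subseteq> carrier (ultraproduct_ring D R)"
  shows "\<forall>\<^sub>F s in D. set (coordinate_poly p s) \<subseteq> carrier (R s)"
proof -
  have "\<forall>\<^sub>F s in D. \<forall>c\<in>set p. urep c s \<in> carrier (R s)"
    using assms by (intro eventually_ball_finite) (auto intro: eventually_urep_carrier)
  then show ?thesis
    by eventually_elim (auto simp: coordinate_poly_def)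
qed

lemma eventually_coordinate_poly_map2:
  "\<forall>\<^sub>F s in D. coordinate_poly (map2 (\<lambda>x y. x \<oplus>\<^bsub>ultraproduct_ring D R\<^esub> y) p q) s =
     map2 (\<lambda>x y. x \<oplus>\<^bsub>R s\<^esub> y) (coordinate_poly p s) (coordinate_poly q s)"
proof -
  have "\<forall>\<^sub>F s in D. \<forall>z\<in>set (zip p q). urep (fst z \<oplus>\<^bsub>ultraproduct_ring D R\<^esub> snd z) s =
      urep (fst z) s \<oplus>\<^bsub>R s\<^esub> urep (snd z) s"
    by (intro eventually_ball_finite ballI eventually_urep_add) simp
  then show ?thesis
    by eventually_elim (auto simp: coordinate_poly_def zip_map1 zip_map2 split: prod.splits)
qed

lemma ring_normalize_Cons:
  "ring R \<Longrightarrow> ring.normalize R (a # p) = (if a \<noteq> \<zero>\<^bsub>R\<^esub> then a # p else ring.normalize R p)"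
  by (simp add: ring.normalize.simps)

lemma ring_poly_add_le:
  assumes "ring R" "length q \<le> length p"
  shows "ring.poly_add R p q =
    ring.normalize R (map2 (\<lambda>x y. x \<oplus>\<^bsub>R\<^esub> y) p (replicate (length p - length q) \<zero>\<^bsub>R\<^esub> @ q))"
  using assms by (simp add: ring.poly_add.simps)

lemma ring_poly_add_gt:
  assumes "ring R" "length p < length q"
  shows "ring.poly_add R p q = ring.poly_add R q p"
  using assms by (subst ring.poly_add.simps) auto

lemma ring_poly_mult_Cons:
  assumes "ring R"
  shows "ring.poly_mult R (a # p) q =
    ring.poly_add R (map (\<lambda>b. a \<otimes>\<^bsub>R\<^esub> b) q @ replicate (length p) \<zero>\<^bsub>R\<^esub>) (ring.poly_mult R p q)"
  using assms by (simp add: ring.poly_mult.simps)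

context ultrafilter
begin

lemma eventually_urep_nonzero:
  assumes "x \<in> carrier (ultraproduct_ring D R)" "x \<noteq> \<zero>\<^bsub>ultraproduct_ring D R\<^esub>"
  shows "\<forall>\<^sub>F s in D. urep x s \<noteq> \<zero>\<^bsub>R s\<^esub>"
proof -
  have "\<not> (\<forall>\<^sub>F s in D. urep x s = \<zero>\<^bsub>R s\<^esub>)"
    using assms(2) ulim_urep_carrier[OF assms(1)] ulim_eq_iff[of D "urep x" "\<lambda>s. \<zero>\<^bsub>R s\<^esub>"]
    unfolding ultraproduct_ring_zero by metis
  then show ?thesis
    by (simp only: not_eventually_iff)
qed

lemma coordinate_poly_inj:
  assumes "set p \<subseteq> carrier (ultraproduct_ring D R)" "set q \<subseteq> carrier (ultraproduct_ring D R)"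
    and eq: "\<forall>\<^sub>F s in D. coordinate_poly p s = coordinate_poly q s"
  shows "p = q"
proof (rule nth_equalityI)
  have "\<exists>s. coordinate_poly p s = coordinate_poly q s"
    using eventually_happens[OF eq] not_bot by simp
  then show len: "length p = length q"
    using length_coordinate_poly by metis
  fix i assume i: "i < length p"
  have "\<forall>\<^sub>F s in D. urep (p ! i) s = urep (q ! i) s"
    using eq
  proof eventually_elim
    case (elim s)
    then have "coordinate_poly p s ! i = coordinate_poly q s ! i"
      by simp
    then show ?case
      using i len by (simp add: coordinate_poly_def)
  qed
  then have "ulim D (urep (p ! i)) = ulim D (urep (q ! i))"
    unfolding ulim_eq_iff .
  moreover have "p ! i \<in> carrier (ultraproduct_ring D R)" "q ! i \<in> carrier (ultraproduct_ring D R)"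
    using assms(1,2) i len by auto
  ultimately show "p ! i = q ! i"
    by (simp add: ulim_urep_carrier)
qed

context
  fixes R :: "'s \<Rightarrow> ('a, 'b) ring_scheme"
  assumes R: "\<forall>\<^sub>F s in D. ring (R s)"
begin

interpretation F: ring "ultraproduct_ring D R"
  by (rule ring_ultraproduct_ring[OF R])

lemma eventually_coordinate_normalize:
  assumes "set p \<subseteq> carrier (ultraproduct_ring D R)"
  shows "\<forall>\<^sub>F s in D. coordinate_poly (F.normalize p) s = ring.normalize (R s) (coordinate_poly p s)"
  using assms
proof (induction p)
  case Nil
  show ?case
    using R by eventually_elim (simp add: coordinate_poly_def ring.normalize.simps)
next
  case (Cons a p)
  show ?case
  proof (cases "a = \<zero>\<^bsub>ultraproduct_ring D R\<^esub>")
    case True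
    have IH: "\<forall>\<^sub>F s in D. coordinate_poly (F.normalize p) s = ring.normalize (R s) (coordinate_poly p s)"
      using Cons by simp
    show ?thesis
      using R IH eventually_urep_zero[of D R]
      by eventually_elim (simp add: True coordinate_poly_def ring_normalize_Cons)
  next
    case False
    then have "\<forall>\<^sub>F s in D. urep a s \<noteq> \<zero>\<^bsub>R s\<^esub>"
      using Cons.prems by (intro eventually_urep_nonzero) auto
    with R show ?thesis
      by eventually_elim (simp add: False coordinate_poly_def ring_normalize_Cons)
  qed
qed

lemma eventually_coordinate_poly_add:
  assumes "set p \<subseteq> carrier (ultraproduct_ring D R)" "set q \<subseteq> carrier (ultraproduct_ring D R)"
  shows "\<forall>\<^sub>F s in D. coordinate_poly (F.poly_add p q) s =
    ring.poly_add (R s) (coordinate_poly p s) (coordinate_poly q s)"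
proof -
  have *: "\<forall>\<^sub>F s in D. coordinate_poly (F.poly_add p q) s =
      ring.poly_add (R s) (coordinate_poly p s) (coordinate_poly q s)"
    if pq: "set p \<subseteq> carrier (ultraproduct_ring D R)" "set q \<subseteq> carrier (ultraproduct_ring D R)"
      "length q \<le> length p" for p q
  proof -
    let ?q = "replicate (length p - length q) \<zero>\<^bsub>ultraproduct_ring D R\<^esub> @ q"
    let ?m = "map2 (\<lambda>x y. x \<oplus>\<^bsub>ultraproduct_ring D R\<^esub> y) p ?q"
    have "set ?q \<subseteq> carrier (ultraproduct_ring D R)"
      using pq by auto
    then have "a \<in> carrier (ultraproduct_ring D R) \<and> b \<in> carrier (ultraproduct_ring D R)"
      if "(a, b) \<in> set (zip p ?q)" for a b
      using set_zip_leftD[OF that] set_zip_rightD[OF that] pq(1) by blast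
    then have "set ?m \<subseteq> carrier (ultraproduct_ring D R)"
      by fastforce
    from R eventually_coordinate_normalize[OF this] eventually_coordinate_poly_map2[of D R p ?q]
      eventually_urep_zero[of D R]
    show ?thesis
    proof eventually_elim
      case (elim s)
      have q: "coordinate_poly ?q s = replicate (length p - length q) \<zero>\<^bsub>R s\<^esub> @ coordinate_poly q s"
        using elim(4) by (simp add: coordinate_poly_def)
      have "F.poly_add p q = F.normalize ?m"
        by (rule ring_poly_add_le[OF F.ring_axioms pq(3)])
      then show ?case
        using elim(2,3) q ring_poly_add_le[OF elim(1), of "coordinate_poly q s" "coordinate_poly p s"] pq(3)
        by simp
    qed
  qed
  show ?thesis
  proof (cases "length q \<le> length p")
    case True
    then show ?thesis
      using * assms by simp
  next
    case False
    then have lt: "length p < length q"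
      by simp
    have "\<forall>\<^sub>F s in D. coordinate_poly (F.poly_add q p) s =
        ring.poly_add (R s) (coordinate_poly q s) (coordinate_poly p s)"
      using *[OF assms(2,1)] lt by simp
    with R show ?thesis
    proof eventually_elim
      case (elim s)
      show ?case
        unfolding ring_poly_add_gt[OF F.ring_axioms lt] elim(2)
        using ring_poly_add_gt[OF elim(1), of "coordinate_poly p s" "coordinate_poly q s"] lt by simp
    qed
  qed
qed

lemma eventually_coordinate_poly_mult:
  assumes "set p \<subseteq> carrier (ultraproduct_ring D R)" "set q \<subseteq> carrier (ultraproduct_ring D R)"
  shows "\<forall>\<^sub>F s in D. coordinate_poly (F.poly_mult p q) s =
    ring.poly_mult (R s) (coordinate_poly p s) (coordinate_poly q s)"
  using assms(1)
proof (induction p)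
  case Nil
  show ?case
    using R by eventually_elim (simp add: coordinate_poly_def ring.poly_mult.simps)
next
  case (Cons a p)
  let ?aq = "map (\<lambda>b. a \<otimes>\<^bsub>ultraproduct_ring D R\<^esub> b) q @ replicate (length p) \<zero>\<^bsub>ultraproduct_ring D R\<^esub>"
  have c: "set ?aq \<subseteq> carrier (ultraproduct_ring D R)"
      "set (F.poly_mult p q) \<subseteq> carrier (ultraproduct_ring D R)"
    using Cons.prems assms(2) F.poly_mult_in_carrier by auto
  have IH: "\<forall>\<^sub>F s in D. coordinate_poly (F.poly_mult p q) s =
      ring.poly_mult (R s) (coordinate_poly p s) (coordinate_poly q s)"
    using Cons by simp
  have "\<forall>\<^sub>F s in D. \<forall>b\<in>set q. urep (a \<otimes>\<^bsub>ultraproduct_ring D R\<^esub> b) s = urep a s \<otimes>\<^bsub>R s\<^esub> urep b s"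
    by (intro eventually_ball_finite ballI eventually_urep_mult) simp
  with R IH eventually_coordinate_poly_add[OF c] eventually_urep_zero[of D R]
  show ?case
  proof eventually_elim
    case (elim s)
    have aq: "coordinate_poly ?aq s =
        map (\<lambda>b. urep a s \<otimes>\<^bsub>R s\<^esub> b) (coordinate_poly q s) @ replicate (length (coordinate_poly p s)) \<zero>\<^bsub>R s\<^esub>"
      using elim(4,5) by (auto simp: coordinate_poly_def)
    have "coordinate_poly (a # p) s = urep a s # coordinate_poly p s"
      by (simp add: coordinate_poly_def)
    then show ?case
      unfolding ring_poly_mult_Cons[OF F.ring_axioms] elim(3) aq elim(2)
      using ring_poly_mult_Cons[OF elim(1), of "urep a s" "coordinate_poly p s" "coordinate_poly q s"]
      by simp
  qed
qed

end

lemma eventually_coordinate_poly_polynomial: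
  assumes "p \<in> carrier (poly_ring (ultraproduct_ring D R))"
  shows "\<forall>\<^sub>F s in D. coordinate_poly p s \<in> carrier (poly_ring (R s))"
proof (cases "p = []")
  case True
  then show ?thesis
    by (simp add: coordinate_poly_def univ_poly_zero_closed)
next
  case False
  then have p: "set p \<subseteq> carrier (ultraproduct_ring D R)" "hd p \<noteq> \<zero>\<^bsub>ultraproduct_ring D R\<^esub>"
    using assms by (auto simp: univ_poly_carrier[symmetric] polynomial_def)
  have "\<forall>\<^sub>F s in D. urep (hd p) s \<noteq> \<zero>\<^bsub>R s\<^esub>"
    using subsetD[OF p(1) hd_in_set[OF False]] p(2) by (rule eventually_urep_nonzero)
  then show ?thesis
    using eventually_coordinate_poly_carrier[OF p(1)]
    by eventually_elim
      (use False in \<open>auto simp: univ_poly_carrier[symmetric] polynomial_def coordinate_poly_def hd_map\<close>)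
qed

lemma hull_embed_eq_coordinate_poly:
  assumes R: "\<forall>\<^sub>F s in D. ring (R s)" and p: "p \<in> carrier (poly_ring (ultraproduct_ring D R))"
  shows "hull_embed D R p = ulim D (coordinate_poly p)"
  unfolding hull_embed_def ulim_eq_iff coordinate_poly_def[symmetric]
  using R eventually_coordinate_poly_polynomial[OF p]
  by eventually_elim (auto simp: univ_poly_carrier[symmetric] intro: ring.normalize_polynomial)

text \<open>Families of polynomials with constant length are almost everywhere the coordinates of one
  polynomial over the ultraproduct, whose coefficients are the ultralimits of theirs.\<close>

lemma coordinate_poly_surj:
  assumes len: "\<forall>\<^sub>F s in D. length (A s) = k"
    and A: "\<forall>\<^sub>F s in D. A s \<in> carrier (poly_ring (R s))"
  shows "\<exists>p\<in>carrier (poly_ring (ultraproduct_ring D R)). length p = k \<and>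
    (\<forall>\<^sub>F s in D. coordinate_poly p s = A s)"
proof -
  define p where "p = map (\<lambda>i. ulim D (\<lambda>s. A s ! i)) [0..<k]"
  have "\<forall>\<^sub>F s in D. \<forall>i\<in>{..<k}. urep (ulim D (\<lambda>s. A s ! i)) s = A s ! i"
    by (intro eventually_ball_finite ballI urep_ulim) simp
  then have co: "\<forall>\<^sub>F s in D. coordinate_poly p s = A s"
    using len by eventually_elim (auto simp: coordinate_poly_def p_def intro!: nth_equalityI)
  have "ulim D (\<lambda>s. A s ! i) \<in> carrier (ultraproduct_ring D R)" if "i < k" for i
    unfolding ulim_in_carrier_iff using A len
    by eventually_elim (use that nth_mem in \<open>fastforce simp: univ_poly_carrier[symmetric] polynomial_def\<close>)
  then have "set p \<subseteq> carrier (ultraproduct_ring D R)"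
    by (auto simp: p_def)
  moreover have "hd p \<noteq> \<zero>\<^bsub>ultraproduct_ring D R\<^esub>" if "p \<noteq> []"
  proof -
    have k: "0 < k"
      using that by (simp add: p_def)
    have "\<forall>\<^sub>F s in D. A s ! 0 \<noteq> \<zero>\<^bsub>R s\<^esub>"
      using A len by eventually_elim (use k in \<open>auto simp: univ_poly_carrier[symmetric] polynomial_def hd_conv_nth\<close>)
    then have "ulim D (\<lambda>s. A s ! 0) \<noteq> \<zero>\<^bsub>ultraproduct_ring D R\<^esub>"
      unfolding ultraproduct_ring_zero ulim_eq_iff not_eventually_iff .
    then show ?thesis
      using k by (simp add: p_def hd_map)
  qed
  ultimately have "p \<in> carrier (poly_ring (ultraproduct_ring D R))"
    by (auto simp: univ_poly_carrier[symmetric] polynomial_def)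
  then show ?thesis
    using co by (intro bexI[of _ p]) (simp add: p_def)
qed

end

lemma (in field) univ_poly_units_iff_length:
  "f \<in> Units (poly_ring R) \<longleftrightarrow> f \<in> carrier (poly_ring R) \<and> length f = 1"
proof -
  have "f \<in> Units (poly_ring R) \<longleftrightarrow> (\<exists>k. f = [k] \<and> k \<in> carrier R - {\<zero>})"
    unfolding univ_poly_units[OF carrier_is_subfield] by blast
  also have "\<dots> \<longleftrightarrow> f \<in> carrier (poly_ring R) \<and> length f = 1"
    by (cases f) (auto simp: univ_poly_carrier[symmetric] polynomial_def)
  finally show ?thesis .
qed

text \<open>The bounded range of \<open>k\<close>, the length of the first factor, is what makes a factorization at almost
  every index of an ultraproduct have a constant degree on a large set.\<close>

lemma (in field) reducible_factors:
  assumes P: "P \<in> carrier (poly_ring R)" "length P \<ge> 2" "\<not> pirreducible (carrier R) P"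
  shows "\<exists>k\<in>{2..<length P}. \<exists>A B. A \<in> carrier (poly_ring R) \<and> B \<in> carrier (poly_ring R) \<and>
    length A = k \<and> length B = length P + 1 - k \<and> P = poly_mult A B"
proof -
  have "P \<notin> Units (poly_ring R)"
    using P(2) by (simp add: univ_poly_units_iff_length)
  then obtain A B where AB: "A \<in> carrier (poly_ring R)" "B \<in> carrier (poly_ring R)"
      "P = A \<otimes>\<^bsub>poly_ring R\<^esub> B" "A \<notin> Units (poly_ring R)" "B \<notin> Units (poly_ring R)"
    using pirreducibleI[OF carrier_is_subring P(1)] P(2,3) by fastforce
  have eq: "P = poly_mult A B"
    using AB(3) by (simp add: univ_poly_mult)
  have pol: "polynomial (carrier R) A" "polynomial (carrier R) B"
    using AB by (simp_all add: univ_poly_carrier)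
  have "P \<noteq> []"
    using P(2) by auto
  then have ne: "A \<noteq> []" "B \<noteq> []"
    using eq poly_mult_zero polynomial_in_carrier[OF carrier_is_subring] pol by auto
  have "degree P = degree A + degree B"
    unfolding eq using poly_mult_degree_eq[OF carrier_is_subring pol] ne by simp
  then have "length P + 1 = length A + length B"
    using ne P(2) by (cases A; cases B) auto
  moreover have "length A \<ge> 2" "length B \<ge> 2"
    using AB(1,2,4,5) ne univ_poly_units_iff_length[of A] univ_poly_units_iff_length[of B]
    by (cases A; cases B; auto simp: Suc_le_eq)+
  ultimately show ?thesis
    using AB(1,2) eq by (intro bexI[of _ "length A"] exI[of _ A] exI[of _ B]) auto
qed

context ultrafilter
begin

text \<open>If the coordinates of \<open>P\<close> were reducible at almost every index, then factors of constant degrees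
  could be chosen there, and the factors would glue to a factorization of \<open>P\<close>.\<close>

lemma eventually_pirreducible:
  assumes K: "\<forall>\<^sub>F s in D. field (K s)"
    and P: "P \<in> carrier (poly_ring (ultraproduct_ring D K))"
      "pirreducible\<^bsub>ultraproduct_ring D K\<^esub> (carrier (ultraproduct_ring D K)) P"
  shows "\<forall>\<^sub>F s in D. pirreducible\<^bsub>K s\<^esub> (carrier (K s)) (coordinate_poly P s)"
proof (rule ccontr)
  let ?F = "ultraproduct_ring D K"
  interpret F: field ?F
    by (rule field_ultraproduct_ring[OF K])
  have R: "\<forall>\<^sub>F s in D. ring (K s)"
    using K by eventually_elim (simp add: field.is_ring)
  have len: "length P \<ge> 2"
    using F.pirreducible_degree[OF F.carrier_is_subfield P] by simp
  assume "\<not> ?thesis"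
  then have "\<forall>\<^sub>F s in D. \<not> pirreducible\<^bsub>K s\<^esub> (carrier (K s)) (coordinate_poly P s)"
    by (simp only: not_eventually_iff)
  with K eventually_coordinate_poly_polynomial[OF P(1)]
  have "\<forall>\<^sub>F s in D. \<exists>k\<in>{2..<length P}. \<exists>A B. A \<in> carrier (poly_ring (K s)) \<and>
      B \<in> carrier (poly_ring (K s)) \<and> length A = k \<and> length B = length P + 1 - k \<and>
      coordinate_poly P s = ring.poly_mult (K s) A B"
  proof eventually_elim
    case (elim s)
    then show ?case
      using field.reducible_factors[of "K s" "coordinate_poly P s"] len by simp
  qed
  then obtain k where k: "2 \<le> k" "k < length P"
    and ev: "\<forall>\<^sub>F s in D. \<exists>A B. A \<in> carrier (poly_ring (K s)) \<and>
      B \<in> carrier (poly_ring (K s)) \<and> length A = k \<and> length B = length P + 1 - k \<and>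
      coordinate_poly P s = ring.poly_mult (K s) A B"
    using eventually_bex_finite[of "{2..<length P}"] by force
  from ev obtain A B where AB: "\<forall>\<^sub>F s in D. A s \<in> carrier (poly_ring (K s)) \<and>
      B s \<in> carrier (poly_ring (K s)) \<and> length (A s) = k \<and> length (B s) = length P + 1 - k \<and>
      coordinate_poly P s = ring.poly_mult (K s) (A s) (B s)"
    unfolding eventually_ex by blast
  obtain A' where A': "A' \<in> carrier (poly_ring ?F)" "length A' = k"
      "\<forall>\<^sub>F s in D. coordinate_poly A' s = A s"
    using coordinate_poly_surj[of A k K] AB by (auto simp: eventually_conj_iff)
  obtain B' where B': "B' \<in> carrier (poly_ring ?F)" "length B' = length P + 1 - k"
      "\<forall>\<^sub>F s in D. coordinate_poly B' s = B s"
    using coordinate_poly_surj[of B "length P + 1 - k" K] AB by (auto simp: eventually_conj_iff)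
  have c: "set A' \<subseteq> carrier ?F" "set B' \<subseteq> carrier ?F" "set P \<subseteq> carrier ?F"
    using A'(1) B'(1) P(1) by (auto simp: univ_poly_carrier[symmetric] polynomial_def)
  have "\<forall>\<^sub>F s in D. coordinate_poly P s = coordinate_poly (F.poly_mult A' B') s"
    using eventually_coordinate_poly_mult[OF R c(1,2)] A'(3) B'(3) AB by eventually_elim simp
  then have "P = F.poly_mult A' B'"
    by (rule coordinate_poly_inj[OF c(3) F.poly_mult_in_carrier[OF c(1,2)]])
  then have "A' \<in> Units (poly_ring ?F) \<or> B' \<in> Units (poly_ring ?F)"
    using F.pirreducibleE(3)[OF F.carrier_is_subring P A'(1) B'(1)] by (simp add: univ_poly_mult)
  then have "length A' = 1 \<or> length B' = 1"
    unfolding F.univ_poly_units_iff_length by blast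
  then show False
    using k A'(2) B'(2) by auto
qed

end

section \<open>Hyperintegers\<close>

lemma ring_int: "ring \<Z>"
  using int_is_cring by (rule cring.axioms)

lemma hyperint_minus: "ulim D a \<ominus>\<^bsub>hyperint D\<^esub> ulim D b = ulim D (\<lambda>s. a s - b s)"
proof -
  have "ulim D a \<ominus>\<^bsub>hyperint D\<^esub> ulim D b = ulim D (\<lambda>s. a s \<ominus>\<^bsub>\<Z>\<^esub> b s)"
    unfolding hyperint_def by (rule ultraproduct_ring_minus) (simp_all add: ring_int)
  moreover have "a s \<ominus>\<^bsub>\<Z>\<^esub> b s = a s - b s" for s
    by (rule int_a_minus_eq)
  ultimately show ?thesis
    by simp
qed

lemma hyperint_one: "\<one>\<^bsub>hyperint D\<^esub> = ulim D (\<lambda>_. 1)"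
  by (simp add: hyperint_def ultraproduct_ring_one)

lemma hyperint_mult: "ulim D a \<otimes>\<^bsub>hyperint D\<^esub> ulim D b = ulim D (\<lambda>s. a s * b s)"
  by (simp add: hyperint_def ultraproduct_ring_mult)

lemma int_ring_pow: "(x::int) [^]\<^bsub>\<Z>\<^esub> (k::nat) = x ^ k"
  by (induction k) simp_all

lemma hyperint_pow: "ulim D a [^]\<^bsub>hyperint D\<^esub> (k::nat) = ulim D (\<lambda>s. a s ^ k)"
  by (simp add: hyperint_def ultraproduct_ring_pow int_ring_pow)

lemma hyper_quot_ulim:
  assumes "\<forall>\<^sub>F s in D. b s \<noteq> 0" "\<forall>\<^sub>F s in D. a s = b s * c s"
  shows "hyper_quot D (ulim D a) (ulim D b) = ulim D c"
  unfolding hyper_quot_def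
proof (rule the_equality)
  show "ulim D c \<in> carrier (hyperint D) \<and> ulim D a = ulim D b \<otimes>\<^bsub>hyperint D\<^esub> ulim D c"
    using assms(2) unfolding hyperint_mult ulim_eq_iff by (simp add: hyperint_def ulim_in_carrier_iff)
next
  fix x assume x: "x \<in> carrier (hyperint D) \<and> ulim D a = ulim D b \<otimes>\<^bsub>hyperint D\<^esub> x"
  then obtain c' where c': "x = ulim D c'"
    unfolding hyperint_def by (auto elim: ultraproduct_ringE)
  have "\<forall>\<^sub>F s in D. a s = b s * c' s"
    using x unfolding c' hyperint_mult ulim_eq_iff by simp
  with assms show "x = ulim D c"
    unfolding c' ulim_eq_iff by eventually_elim simp
qed


section \<open>The power residue symbol as an ultralimit\<close>

text \<open>A constant in the ideal of a nonconstant polynomial is zero, so a residue class contains at most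
  one constant.\<close>

lemma (in field) residue_const_unique:
  assumes P: "P \<in> carrier (poly_ring R)" "length P \<ge> 2"
    and f: "f \<in> carrier (poly_ring R)" and c: "c \<in> carrier R" "c' \<in> carrier R"
    and mem: "f \<ominus>\<^bsub>poly_ring R\<^esub> poly_of_const c \<in> PIdl\<^bsub>poly_ring R\<^esub> P"
      "f \<ominus>\<^bsub>poly_ring R\<^esub> poly_of_const c' \<in> PIdl\<^bsub>poly_ring R\<^esub> P"
  shows "c = c'"
proof -
  interpret UP: domain "poly_ring R"
    by (rule univ_poly_is_domain[OF carrier_is_subring])
  interpret I: ideal "PIdl\<^bsub>poly_ring R\<^esub> P" "poly_ring R"
    by (rule UP.cgenideal_ideal[OF P(1)])
  interpret C: ring_hom_ring R "poly_ring R" poly_of_const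
    using canonical_embedding_ring_hom[OF carrier_is_subring] by simp
  have cc: "poly_of_const c \<in> carrier (poly_ring R)" "poly_of_const c' \<in> carrier (poly_ring R)"
    using C.hom_closed[OF c(1)] C.hom_closed[OF c(2)] by blast+
  have d: "c' \<ominus> c \<in> carrier R"
    by (rule minus_closed[OF c(2,1)])
  have "poly_of_const (c' \<ominus> c) = poly_of_const c' \<ominus>\<^bsub>poly_ring R\<^esub> poly_of_const c"
    unfolding a_minus_def C.hom_add[OF c(2) a_inv_closed[OF c(1)]] C.hom_a_inv[OF c(1)] ..
  also have "\<dots> = (f \<ominus>\<^bsub>poly_ring R\<^esub> poly_of_const c) \<oplus>\<^bsub>poly_ring R\<^esub>
      \<ominus>\<^bsub>poly_ring R\<^esub> (f \<ominus>\<^bsub>poly_ring R\<^esub> poly_of_const c')"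
    using f cc by algebra
  finally have "poly_of_const (c' \<ominus> c) \<in> PIdl\<^bsub>poly_ring R\<^esub> P"
    using I.a_closed[OF mem(1) I.a_inv_closed[OF mem(2)]] by (simp only:)
  then obtain r where r: "r \<in> carrier (poly_ring R)" "poly_of_const (c' \<ominus> c) = r \<otimes>\<^bsub>poly_ring R\<^esub> P"
    unfolding cgenideal_def by blast
  have div: "P pdivides poly_of_const (c' \<ominus> c)"
    unfolding pdivides_def factor_def r(2) using r(1) UP.m_comm[OF r(1) P(1)] by blast
  have "c' \<ominus> c = \<zero>"
  proof (rule ccontr)
    assume "c' \<ominus> c \<noteq> \<zero>"
    then have eq: "poly_of_const (c' \<ominus> c) = [c' \<ominus> c]"
      by (simp add: poly_of_const_def)
    have "[c' \<ominus> c] \<in> carrier (poly_ring R)"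
      using C.hom_closed[OF d] unfolding eq .
    then show False
      using pdivides_imp_degree_le[OF carrier_is_subring P(1) _ _ div[unfolded eq]] P(2) by simp
  qed
  then show ?thesis
    using r_right_minus_eq[OF c(2,1)] by blast
qed

lemma (in cring) minus_one_pow_cancel:
  assumes "r \<in> carrier R"
  shows "(\<ominus> \<one>) [^] (k * m) \<otimes> ((\<ominus> \<one>) [^] k \<otimes> r) [^] m = r [^] (m::nat)"
proof -
  let ?n = "\<ominus> \<one>"
  have n: "?n \<in> carrier R"
    by simp
  have "?n [^] (k * m) \<otimes> ?n [^] (k * m) = (?n \<otimes> ?n) [^] (k * m)"
    by (rule nat_pow_distrib[symmetric]) simp_all
  also have "?n \<otimes> ?n = \<one>"
    by (simp add: l_minus)
  finally have sq: "?n [^] (k * m) \<otimes> ?n [^] (k * m) = \<one>"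
    by simp
  have "(?n [^] k \<otimes> r) [^] m = ?n [^] (k * m) \<otimes> r [^] m"
    using assms by (simp add: nat_pow_distrib nat_pow_pow)
  then have "?n [^] (k * m) \<otimes> (?n [^] k \<otimes> r) [^] m = (?n [^] (k * m) \<otimes> ?n [^] (k * m)) \<otimes> r [^] m"
    using assms by (simp add: m_assoc)
  then show ?thesis
    using sq assms by simp
qed

context ultrafilter
begin

lemma hull_embed_const:
  assumes K: "\<forall>\<^sub>F s in D. field (K s)"
    and c: "ulim D c \<in> Units (ultraproduct_ring D K)"
  shows "hull_embed D K (ring.poly_of_const (ultraproduct_ring D K) (ulim D c)) =
    ulim D (\<lambda>s. ring.poly_of_const (K s) (c s))"
proof -
  interpret F: field "ultraproduct_ring D K"
    by (rule field_ultraproduct_ring[OF K])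
  have "ulim D c \<noteq> \<zero>\<^bsub>ultraproduct_ring D K\<^esub>"
    using c F.field_Units by auto
  then have eq: "F.poly_of_const (ulim D c) = [ulim D c]"
    by (simp add: F.poly_of_const_def)
  show ?thesis
    unfolding eq hull_embed_def ulim_eq_iff using K urep_ulim[of D c]
    by eventually_elim (simp add: ring.poly_of_const_def field.is_ring)
qed

text \<open>To evaluate the symbol it suffices to satisfy the defining congruence at almost every index.\<close>

lemma power_residue_symbol_eq_ulim:
  assumes K: "\<forall>\<^sub>F s in D. field (K s)"
    and P: "P \<in> carrier (poly_ring (ultraproduct_ring D K))" "length P \<ge> 2"
    and A: "A \<in> carrier (poly_ring (ultraproduct_ring D K))"
      "\<not> P pdivides\<^bsub>ultraproduct_ring D K\<^esub> A"
    and e: "hyper_quot D (internal_card D K [^]\<^bsub>hyperint D\<^esub> (length P - 1)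
        \<ominus>\<^bsub>hyperint D\<^esub> \<one>\<^bsub>hyperint D\<^esub>) n = ulim D e"
    and c: "\<forall>\<^sub>F s in D. c s \<in> carrier (K s) - {\<zero>\<^bsub>K s\<^esub>}"
    and mem: "\<forall>\<^sub>F s in D. coordinate_poly A s [^]\<^bsub>poly_ring (K s)\<^esub> nat (e s)
        \<ominus>\<^bsub>poly_ring (K s)\<^esub> ring.poly_of_const (K s) (c s) \<in> PIdl\<^bsub>poly_ring (K s)\<^esub> (coordinate_poly P s)"
  shows "power_residue_symbol D K n A P = ulim D c"
proof -
  let ?F = "ultraproduct_ring D K" and ?U = "ultra_hull D K"
  interpret F: field ?F
    by (rule field_ultraproduct_ring[OF K])
  have R: "\<forall>\<^sub>F s in D. ring (K s)"
    using K by eventually_elim (simp add: field.is_ring)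
  have UR: "\<forall>\<^sub>F s in D. ring (poly_ring (K s))"
    using K
  proof eventually_elim
    case (elim s)
    then interpret field "K s" .
    show ?case
      by (rule univ_poly_is_ring[OF carrier_is_subring])
  qed
  have congr: "ultra_pow D (\<lambda>s. poly_ring (K s)) (hull_embed D K A) (ulim D e)
        \<ominus>\<^bsub>?U\<^esub> hull_embed D K (F.poly_of_const (ulim D x)) \<in> PIdl\<^bsub>?U\<^esub> (hull_embed D K P) \<longleftrightarrow>
      (\<forall>\<^sub>F s in D. coordinate_poly A s [^]\<^bsub>poly_ring (K s)\<^esub> nat (e s)
        \<ominus>\<^bsub>poly_ring (K s)\<^esub> ring.poly_of_const (K s) (x s) \<in> PIdl\<^bsub>poly_ring (K s)\<^esub> (coordinate_poly P s))"
    if x: "ulim D x \<in> Units ?F" for x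
  proof -
    have "\<forall>\<^sub>F s in D. x s \<in> carrier (K s)"
      using F.Units_closed[OF x] by (simp add: ulim_in_carrier_iff)
    with R have cc: "\<forall>\<^sub>F s in D. ring.poly_of_const (K s) (x s) \<in> carrier (poly_ring (K s))"
      by eventually_elim
        (simp add: ring.poly_of_const_def univ_poly_carrier[symmetric] ring.normalize_gives_polynomial)
    show ?thesis
      unfolding hull_embed_const[OF K x] hull_embed_eq_coordinate_poly[OF R A(1)]
        hull_embed_eq_coordinate_poly[OF R P(1)] ultra_pow_ulim ultra_hull_def
        ultraproduct_ring_minus[OF UR cc] ulim_mem_PIdl_iff ..
  qed
  have cU: "ulim D c \<in> Units ?F"
  proof -
    have "ulim D c \<in> carrier ?F"
      unfolding ulim_in_carrier_iff using c by eventually_elim simp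
    moreover have "ulim D c \<noteq> \<zero>\<^bsub>?F\<^esub>"
      unfolding ultraproduct_ring_zero ulim_eq_iff not_eventually_iff using c by eventually_elim simp
    ultimately show ?thesis
      using F.field_Units by simp
  qed
  have "(THE x. x \<in> Units ?F \<and> ultra_pow D (\<lambda>s. poly_ring (K s)) (hull_embed D K A) (ulim D e)
      \<ominus>\<^bsub>?U\<^esub> hull_embed D K (F.poly_of_const x) \<in> PIdl\<^bsub>?U\<^esub> (hull_embed D K P)) = ulim D c"
  proof (rule the_equality)
    show "ulim D c \<in> Units ?F \<and> ultra_pow D (\<lambda>s. poly_ring (K s)) (hull_embed D K A) (ulim D e)
        \<ominus>\<^bsub>?U\<^esub> hull_embed D K (F.poly_of_const (ulim D c)) \<in> PIdl\<^bsub>?U\<^esub> (hull_embed D K P)"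
      unfolding congr[OF cU] using cU mem by blast
  next
    fix y assume y: "y \<in> Units ?F \<and> ultra_pow D (\<lambda>s. poly_ring (K s)) (hull_embed D K A) (ulim D e)
        \<ominus>\<^bsub>?U\<^esub> hull_embed D K (F.poly_of_const y) \<in> PIdl\<^bsub>?U\<^esub> (hull_embed D K P)"
    then have yc: "y \<in> carrier ?F"
      using F.Units_closed by blast
    then obtain x where x: "y = ulim D x" "\<forall>\<^sub>F s in D. x s \<in> carrier (K s)"
      by (rule ultraproduct_ringE)
    have xU: "ulim D x \<in> Units ?F"
      using y x(1) by simp
    have memx: "\<forall>\<^sub>F s in D. coordinate_poly A s [^]\<^bsub>poly_ring (K s)\<^esub> nat (e s)
        \<ominus>\<^bsub>poly_ring (K s)\<^esub> ring.poly_of_const (K s) (x s) \<in> PIdl\<^bsub>poly_ring (K s)\<^esub> (coordinate_poly P s)"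
      using y unfolding x(1) congr[OF xU] by simp
    show "y = ulim D c"
      unfolding x(1) ulim_eq_iff
      using K x(2) c mem memx eventually_coordinate_poly_polynomial[OF P(1)]
        eventually_coordinate_poly_polynomial[OF A(1)]
    proof eventually_elim
      case (elim s)
      interpret field "K s"
        by (rule elim(1))
      interpret UP: domain "poly_ring (K s)"
        by (rule univ_poly_is_domain[OF carrier_is_subring])
      show ?case
        using elim(2,3) P(2)
        by (intro residue_const_unique[OF elim(6) _ UP.nat_pow_closed[OF elim(7)] _ _ elim(5,4)]) simp_all
    qed
  qed
  then show ?thesis
    unfolding power_residue_symbol_def Let_def e using A(2) by simp
qed

end

lemma power_minus_one_eq_sum:
  "int q ^ d - 1 = (int q - 1) * int (\<Sum>i<d. q ^ i)"
  by (simp add: power_diff_1_eq)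

section \<open>Reciprocity over an ultra-finite field\<close>

theorem theorem1p2:
  fixes D :: "'s filter"
    and K :: "'s \<Rightarrow> ('a, 'b) ring_scheme"
    and n :: "('s \<Rightarrow> int) set"
    and P Q :: "('s \<Rightarrow> 'a) set list"
    and d l :: nat
  assumes "infinite (UNIV :: 's set)"
    and "nonprincipal_ultrafilter D"
    and "\<forall>\<^sub>F s in D. field (K s) \<and> finite (carrier (K s))"
    and "n \<in> hypernat D"
    and "n divides\<^bsub>hyperint D\<^esub> (internal_card D K \<ominus>\<^bsub>hyperint D\<^esub> \<one>\<^bsub>hyperint D\<^esub>)"
    and "P \<in> carrier (poly_ring (ultraproduct_ring D K))"
    and "Q \<in> carrier (poly_ring (ultraproduct_ring D K))"
    and "Polynomials.lead_coeff P = \<one>\<^bsub>ultraproduct_ring D K\<^esub>"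
    and "Polynomials.lead_coeff Q = \<one>\<^bsub>ultraproduct_ring D K\<^esub>"
    and "pirreducible\<^bsub>ultraproduct_ring D K\<^esub> (carrier (ultraproduct_ring D K)) P"
    and "pirreducible\<^bsub>ultraproduct_ring D K\<^esub> (carrier (ultraproduct_ring D K)) Q"
    and "Polynomials.degree P = d"
    and "Polynomials.degree Q = l"
  shows "power_residue_symbol D K n Q P =
      ultra_pow D K (\<ominus>\<^bsub>ultraproduct_ring D K\<^esub> \<one>\<^bsub>ultraproduct_ring D K\<^esub>)
        (hyper_quot D (internal_card D K \<ominus>\<^bsub>hyperint D\<^esub> \<one>\<^bsub>hyperint D\<^esub>) n
          \<otimes>\<^bsub>hyperint D\<^esub> hyper_of_int D (int d) \<otimes>\<^bsub>hyperint D\<^esub> hyper_of_int D (int l))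
      \<otimes>\<^bsub>ultraproduct_ring D K\<^esub> power_residue_symbol D K n P Q"
proof -
  let ?F = "ultraproduct_ring D K"
  note P = assms(6,10,8) and Q = assms(7,11,9)
  note d = assms(12) and l = assms(13)
  interpret ultrafilter D
    using assms(2) by unfold_locales (auto simp: nonprincipal_ultrafilter_def)
  have K: "\<forall>\<^sub>F s in D. field (K s)"
    using assms(3) by eventually_elim simp
  have R: "\<forall>\<^sub>F s in D. ring (K s)"
    using K by eventually_elim (simp add: field.is_ring)
  interpret F: field ?F
    by (rule field_ultraproduct_ring[OF K])
  \<comment> \<open>Here $n$ is the class of \<open>\<nu>\<close>, and $(\kappa - 1)/n$ is the class of \<open>\<gamma>\<close>.\<close>
  obtain \<nu> where \<nu>: "n = ulim D \<nu>" "\<forall>\<^sub>F s in D. \<nu> s \<ge> 1"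
    using assms(4) by (auto simp: hypernat_def ultraproduct_def)
  obtain m where "m \<in> carrier (hyperint D)"
      and nm: "internal_card D K \<ominus>\<^bsub>hyperint D\<^esub> \<one>\<^bsub>hyperint D\<^esub> = n \<otimes>\<^bsub>hyperint D\<^esub> m"
    using assms(5) by (auto simp: factor_def)
  then obtain \<gamma> where \<gamma>: "m = ulim D \<gamma>"
    unfolding hyperint_def by (auto elim: ultraproduct_ringE)
  define q where "q s = card (carrier (K s))" for s
  have card_minus: "\<forall>\<^sub>F s in D. int (q s) - 1 = \<nu> s * \<gamma> s"
    using nm unfolding internal_card_def hyperint_one hyperint_minus \<nu>(1) \<gamma> hyperint_mult ulim_eq_iff q_def .
  have nz: "\<forall>\<^sub>F s in D. \<nu> s \<noteq> 0"
    using \<nu>(2) by eventually_elim simp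
  have quot: "hyper_quot D (internal_card D K \<ominus>\<^bsub>hyperint D\<^esub> \<one>\<^bsub>hyperint D\<^esub>) n = ulim D \<gamma>"
    unfolding internal_card_def hyperint_one hyperint_minus \<nu>(1) q_def[symmetric]
    by (rule hyper_quot_ulim[OF nz card_minus])
  have quot_pow: "hyper_quot D (internal_card D K [^]\<^bsub>hyperint D\<^esub> k \<ominus>\<^bsub>hyperint D\<^esub> \<one>\<^bsub>hyperint D\<^esub>) n
      = ulim D (\<lambda>s. int (\<Sum>i<k. q s ^ i) * \<gamma> s)" for k :: nat
    unfolding internal_card_def hyperint_pow hyperint_one hyperint_minus \<nu>(1) q_def[symmetric]
    by (rule hyper_quot_ulim[OF nz])
      (use card_minus in eventually_elim, simp only: power_minus_one_eq_sum mult_ac)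
  have \<gamma>_nonneg: "\<forall>\<^sub>F s in D. \<gamma> s \<ge> 0"
    using assms(3) \<nu>(2) card_minus
  proof eventually_elim
    case (elim s)
    then interpret field "K s"
      by simp
    have "q s \<noteq> 0"
      unfolding q_def using elim(1) by auto
    then have "0 \<le> \<nu> s * \<gamma> s"
      using elim(3) by simp
    then show ?case
      using elim(2) by (simp add: zero_le_mult_iff)
  qed
  have minus_one: "\<ominus>\<^bsub>?F\<^esub> \<one>\<^bsub>?F\<^esub> = ulim D (\<lambda>s. \<ominus>\<^bsub>K s\<^esub> \<one>\<^bsub>K s\<^esub>)"
  proof -
    have "\<forall>\<^sub>F s in D. \<one>\<^bsub>K s\<^esub> \<in> carrier (K s)"
      using R by eventually_elim (simp add: ring.ring_simprules)
    then show ?thesis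
      unfolding ultraproduct_ring_one by (rule ultraproduct_ring_a_inv[OF R])
  qed
  have sign: "ultra_pow D K (\<ominus>\<^bsub>?F\<^esub> \<one>\<^bsub>?F\<^esub>)
      (hyper_quot D (internal_card D K \<ominus>\<^bsub>hyperint D\<^esub> \<one>\<^bsub>hyperint D\<^esub>) n
        \<otimes>\<^bsub>hyperint D\<^esub> hyper_of_int D (int d) \<otimes>\<^bsub>hyperint D\<^esub> hyper_of_int D (int l)) =
      ulim D (\<lambda>s. (\<ominus>\<^bsub>K s\<^esub> \<one>\<^bsub>K s\<^esub>) [^]\<^bsub>K s\<^esub> nat (\<gamma> s * int d * int l))"
    unfolding quot minus_one hyper_of_int_def hyperint_mult ultra_pow_ulim ..
  show ?thesis
  proof (cases "P = Q")
    case True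
    \<comment> \<open>Both symbols are zero.\<close>
    have "P pdivides\<^bsub>?F\<^esub> P"
      unfolding pdivides_def factor_def
      using P(1) F.univ_poly_is_ring[OF F.carrier_is_subring]
      by (intro bexI[of _ "\<one>\<^bsub>poly_ring ?F\<^esub>"]) (auto simp: ring.ring_simprules monoid.r_one ring.is_monoid)
    then have zero: "power_residue_symbol D K n P P = \<zero>\<^bsub>?F\<^esub>"
      by (simp add: power_residue_symbol_def)
    have "ulim D (\<lambda>s. (\<ominus>\<^bsub>K s\<^esub> \<one>\<^bsub>K s\<^esub>) [^]\<^bsub>K s\<^esub> nat (\<gamma> s * int d * int l)) \<in> carrier ?F"
      unfolding ulim_in_carrier_iff using R
      by eventually_elim (simp add: monoid.nat_pow_closed ring.is_monoid ring.ring_simprules)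
    then show ?thesis
      unfolding sign True[symmetric] zero by simp
  next
    case False
    have not_div: "\<not> A pdivides\<^bsub>?F\<^esub> B" if "A \<noteq> B"
      and A: "A \<in> carrier (poly_ring ?F)" "pirreducible\<^bsub>?F\<^esub> (carrier ?F) A" "hd A = \<one>\<^bsub>?F\<^esub>"
      and B: "B \<in> carrier (poly_ring ?F)" "pirreducible\<^bsub>?F\<^esub> (carrier ?F) B" "hd B = \<one>\<^bsub>?F\<^esub>" for A B
    proof
      interpret UP: domain "poly_ring ?F"
        by (rule F.univ_poly_is_domain[OF F.carrier_is_subring])
      assume "A pdivides\<^bsub>?F\<^esub> B"
      then obtain C where C: "C \<in> carrier (poly_ring ?F)" "B = A \<otimes>\<^bsub>poly_ring ?F\<^esub> C"
        unfolding pdivides_def factor_def by blast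
      then have "B \<in> PIdl\<^bsub>poly_ring ?F\<^esub> A"
        unfolding cgenideal_def using UP.m_comm[OF A(1) C(1)] by blast
      then show False
        using F.monic_irreducible_eq_if_mem_PIdl[OF A B] \<open>A \<noteq> B\<close> by simp
    qed
    have len: "length A \<ge> 2" if "A \<in> carrier (poly_ring ?F)" "pirreducible\<^bsub>?F\<^esub> (carrier ?F) A" for A
      using F.pirreducible_degree[OF F.carrier_is_subfield that] by simp
    have monic: "\<forall>\<^sub>F s in D. hd (coordinate_poly A s) = \<one>\<^bsub>K s\<^esub>"
      if "length A \<ge> 2" "hd A = \<one>\<^bsub>?F\<^esub>" for A
      using urep_ulim[of D "\<lambda>s. \<one>\<^bsub>K s\<^esub>"]
      by eventually_elim (use that in \<open>cases A; simp add: coordinate_poly_def ultraproduct_ring_one\<close>)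
    have c: "set P \<subseteq> carrier ?F" "set Q \<subseteq> carrier ?F"
      using P(1) Q(1) by (auto simp: univ_poly_carrier[symmetric] polynomial_def)
    have "\<not> (\<forall>\<^sub>F s in D. coordinate_poly P s = coordinate_poly Q s)"
      using coordinate_poly_inj[OF c] False by blast
    then have distinct: "\<forall>\<^sub>F s in D. coordinate_poly P s \<noteq> coordinate_poly Q s"
      by (simp only: not_eventually_iff)
    have "\<forall>\<^sub>F s in D. \<exists>r. r \<in> carrier (K s) - {\<zero>\<^bsub>K s\<^esub>} \<and> (\<forall>m::nat.
        coordinate_poly Q s [^]\<^bsub>poly_ring (K s)\<^esub> ((\<Sum>i<d. q s ^ i) * m) \<ominus>\<^bsub>poly_ring (K s)\<^esub>
          ring.poly_of_const (K s) (r [^]\<^bsub>K s\<^esub> m) \<in> PIdl\<^bsub>poly_ring (K s)\<^esub> (coordinate_poly P s) \<and>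
        coordinate_poly P s [^]\<^bsub>poly_ring (K s)\<^esub> ((\<Sum>i<l. q s ^ i) * m) \<ominus>\<^bsub>poly_ring (K s)\<^esub>
          ring.poly_of_const (K s) (((\<ominus>\<^bsub>K s\<^esub> \<one>\<^bsub>K s\<^esub>) [^]\<^bsub>K s\<^esub> (d * l) \<otimes>\<^bsub>K s\<^esub> r) [^]\<^bsub>K s\<^esub> m)
            \<in> PIdl\<^bsub>poly_ring (K s)\<^esub> (coordinate_poly Q s))"
      using assms(3) distinct eventually_coordinate_poly_polynomial[OF P(1)]
        eventually_coordinate_poly_polynomial[OF Q(1)] eventually_pirreducible[OF K P(1,2)]
        eventually_pirreducible[OF K Q(1,2)] monic[OF len[OF P(1,2)] P(3)] monic[OF len[OF Q(1,2)] Q(3)]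
    proof eventually_elim
      case (elim s)
      show ?case
        using finite_field_power_reciprocity[of "K s", OF _ _ elim(3,5,7,4,6,8,2)] elim(1)
        by (simp only: length_coordinate_poly d l q_def[symmetric] Bex_def)
    qed
    then obtain r where r: "\<forall>\<^sub>F s in D. r s \<in> carrier (K s) - {\<zero>\<^bsub>K s\<^esub>} \<and> (\<forall>m::nat.
        coordinate_poly Q s [^]\<^bsub>poly_ring (K s)\<^esub> ((\<Sum>i<d. q s ^ i) * m) \<ominus>\<^bsub>poly_ring (K s)\<^esub>
          ring.poly_of_const (K s) (r s [^]\<^bsub>K s\<^esub> m) \<in> PIdl\<^bsub>poly_ring (K s)\<^esub> (coordinate_poly P s) \<and>
        coordinate_poly P s [^]\<^bsub>poly_ring (K s)\<^esub> ((\<Sum>i<l. q s ^ i) * m) \<ominus>\<^bsub>poly_ring (K s)\<^esub>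
          ring.poly_of_const (K s) (((\<ominus>\<^bsub>K s\<^esub> \<one>\<^bsub>K s\<^esub>) [^]\<^bsub>K s\<^esub> (d * l) \<otimes>\<^bsub>K s\<^esub> r s) [^]\<^bsub>K s\<^esub> m)
            \<in> PIdl\<^bsub>poly_ring (K s)\<^esub> (coordinate_poly Q s))"
      unfolding eventually_ex by blast
    \<comment> \<open>At almost every index \<open>s\<close> these are the values of the two symbols.\<close>
    define c1 where "c1 s = r s [^]\<^bsub>K s\<^esub> nat (\<gamma> s)" for s
    define c2 where "c2 s = ((\<ominus>\<^bsub>K s\<^esub> \<one>\<^bsub>K s\<^esub>) [^]\<^bsub>K s\<^esub> (d * l) \<otimes>\<^bsub>K s\<^esub> r s) [^]\<^bsub>K s\<^esub> nat (\<gamma> s)" for s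
    have exponent: "nat (int N * g) = N * nat g" if "g \<ge> 0" for N g
      using that by (simp add: nat_mult_distrib)
    have QP: "power_residue_symbol D K n Q P = ulim D c1"
    proof (rule power_residue_symbol_eq_ulim[OF K P(1) len[OF P(1,2)] Q(1) not_div[OF False P Q]])
      show "hyper_quot D (internal_card D K [^]\<^bsub>hyperint D\<^esub> (length P - 1) \<ominus>\<^bsub>hyperint D\<^esub> \<one>\<^bsub>hyperint D\<^esub>) n
          = ulim D (\<lambda>s. int (\<Sum>i<d. q s ^ i) * \<gamma> s)"
        unfolding d by (rule quot_pow)
      show "\<forall>\<^sub>F s in D. c1 s \<in> carrier (K s) - {\<zero>\<^bsub>K s\<^esub>}"
        using K r
      proof eventually_elim
        case (elim s)
        interpret field "K s"
          by (rule elim(1))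
        have "r s \<in> carrier (K s)" "r s \<noteq> \<zero>\<^bsub>K s\<^esub>"
          using elim(2) by auto
        then show ?case
          unfolding c1_def using pow_eq_zero_imp by auto
      qed
      show "\<forall>\<^sub>F s in D. coordinate_poly Q s [^]\<^bsub>poly_ring (K s)\<^esub> nat (int (\<Sum>i<d. q s ^ i) * \<gamma> s)
          \<ominus>\<^bsub>poly_ring (K s)\<^esub> ring.poly_of_const (K s) (c1 s) \<in> PIdl\<^bsub>poly_ring (K s)\<^esub> (coordinate_poly P s)"
        using \<gamma>_nonneg r by eventually_elim (simp only: exponent c1_def)
    qed
    have PQ: "power_residue_symbol D K n P Q = ulim D c2"
    proof (rule power_residue_symbol_eq_ulim[OF K Q(1) len[OF Q(1,2)] P(1) not_div[OF False[symmetric] Q P]])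
      show "hyper_quot D (internal_card D K [^]\<^bsub>hyperint D\<^esub> (length Q - 1) \<ominus>\<^bsub>hyperint D\<^esub> \<one>\<^bsub>hyperint D\<^esub>) n
          = ulim D (\<lambda>s. int (\<Sum>i<l. q s ^ i) * \<gamma> s)"
        unfolding l by (rule quot_pow)
      show "\<forall>\<^sub>F s in D. c2 s \<in> carrier (K s) - {\<zero>\<^bsub>K s\<^esub>}"
        using K r
      proof eventually_elim
        case (elim s)
        interpret field "K s"
          by (rule elim(1))
        have rs: "r s \<in> carrier (K s)" "r s \<noteq> \<zero>\<^bsub>K s\<^esub>"
          using elim(2) by auto
        have n: "\<ominus>\<^bsub>K s\<^esub> \<one>\<^bsub>K s\<^esub> \<in> carrier (K s)" "\<ominus>\<^bsub>K s\<^esub> \<one>\<^bsub>K s\<^esub> \<noteq> \<zero>\<^bsub>K s\<^esub>"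
          using minus_minus[OF one_closed] by auto
        have w: "(\<ominus>\<^bsub>K s\<^esub> \<one>\<^bsub>K s\<^esub>) [^]\<^bsub>K s\<^esub> (d * l) \<in> carrier (K s)"
          "(\<ominus>\<^bsub>K s\<^esub> \<one>\<^bsub>K s\<^esub>) [^]\<^bsub>K s\<^esub> (d * l) \<noteq> \<zero>\<^bsub>K s\<^esub>"
          using n pow_eq_zero_imp by blast+
        then show ?case
          unfolding c2_def using rs pow_eq_zero_imp integral by blast
      qed
      show "\<forall>\<^sub>F s in D. coordinate_poly P s [^]\<^bsub>poly_ring (K s)\<^esub> nat (int (\<Sum>i<l. q s ^ i) * \<gamma> s)
          \<ominus>\<^bsub>poly_ring (K s)\<^esub> ring.poly_of_const (K s) (c2 s) \<in> PIdl\<^bsub>poly_ring (K s)\<^esub> (coordinate_poly Q s)"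
        using \<gamma>_nonneg r by eventually_elim (simp only: exponent c2_def)
    qed
    show ?thesis
      unfolding QP PQ sign ultraproduct_ring_mult ulim_eq_iff
      using K r \<gamma>_nonneg
    proof eventually_elim
      case (elim s)
      interpret field "K s"
        by (rule elim(1))
      have "nat (\<gamma> s * int d * int l) = d * l * nat (\<gamma> s)"
        using elim(3) exponent[of "\<gamma> s" "d * l"] by (simp add: mult_ac)
      then show ?case
        using minus_one_pow_cancel[of "r s" "d * l" "nat (\<gamma> s)"] elim(2) by (simp add: c1_def c2_def)
    qed
  qed
qed

end
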